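(* Let $R=\mathbb{C}[x_1,\ldots,x_N]$, let $\mathfrak{m}=\langle x_1,\ldots,x_N\rangle$, let $R_0=R_{\mathfrak m}$, and let $I=\langle F\rangle\subset R$ be an ideal given by a finite generating set $F$ and satisfying $I=IR_0\cap R$. Let $\ell\in R$ be a generic linear form. Consider the following procedure, run for $d=0,1,2,\ldots$ in order until it returns: (i) let $J_d=(I:\mathfrak{m}^\infty)\cap R_d$; if $\operatorname{in}_\geq(J_d)\not\subset \operatorname{in}_\geq(I)$, return "true"; (ii) otherwise let $S_d=\ell\cdot D_0^{d+1}[I]$; if $\partial^\alpha\in\operatorname{in}_\succeq(S_d)$ for every s-corner $x^\alpha$ of $\operatorname{in}_\geq(I)$, return "false"; (iii) otherwise increase $d$ by $1$ and repeat. This procedure terminates after finitely many steps, and it returns "true" if and only if the origin is an associated component of $I$, i.e. if and only if $\mathfrak{m}\in\operatorname{Ass}(R/I)$.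
   Context: $R_d$ is the space of polynomials in $R$ all of whose terms have degree $\le d$. $(I:\mathfrak m^\infty)=\bigcup_{k}(I:\mathfrak m^k)$. For $\alpha\in(\mathbb{Z}_{\ge0})^N$ let $\partial^\alpha:R\to\mathbb{C}$ be the functional $g\mapsto \frac{1}{\alpha!}\frac{\partial^{|\alpha|}g}{\partial x^\alpha}(0)$. Let $D_0=\operatorname{span}_{\mathbb C}\{\partial^\alpha\}$ (finite linear combinations), and let $D_0^k$ be the subspace spanned by the $\partial^\alpha$ with $|\alpha|\le k$. The dual space of $I$ is $D_0[I]=\{q\in D_0\mid q(g)=0 \text{ for all } g\in I\}$ and its truncation is $D_0^k[I]=D_0[I]\cap D_0^k$. A polynomial $g\in R$ acts on $D_0$ by $(g\cdot q)(f)=q(gf)$, so $x_i\cdot\partial^\alpha=\partial^{\alpha-e_i}$ (understood as $0$ if $\alpha_i=0$). Fix a local monomial order $\geq$ on the monomials of $R$ (a total order respecting multiplication, with $1$ the largest monomial). For a nonzero polynomial $g$, $\operatorname{in}_\geq(g)$ is the $\geq$-largest monomial occurring in $g$ with nonzero coefficient; for a set $A$ of polynomials, $\operatorname{in}_\geq(A)$ is the set of initial monomials of its nonzero elements. The dual order is $\partial^\alpha\succeq\partial^\beta \Leftrightarrow x^\alpha\le x^\beta$. For nonzero $q\in D_0$, $\operatorname{in}_\succeq(q)$ is the $\succeq$-largest $\partial^\alpha$ occurring in $q$ with nonzero coefficient, and $\operatorname{in}_\succeq(S)$ is the set of initial terms of the nonzero elements of a subspace $S\subset D_0$. An s-corner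 of a monomial ideal $M$ is a monomial $x^\alpha\notin M$ such that $x_ix^\alpha\in M$ for all $i=1,\ldots,N$ (i.e. a monomial in the socle of the quotient by $M$). $\operatorname{in}_\geq(I)$ is regarded as the set of monomials of a monomial ideal. A generic linear form is one whose coefficient vector lies outside some proper Zariski closed subset (depending on $I$) of $\mathbb{C}^N$. *)

theory Defs
  imports
    "HOL-Analysis.Finite_Cartesian_Product"
    "HOL-Library.Poly_Mapping"
    "HOL-Library.While_Combinator"
    "HOL-Computational_Algebra.Fraction_Field"
begin

text \<open>
  The variables are indexed by a finite linearly ordered type \<open>'n\<close>, so that \<open>N = CARD('n)\<close>.
  The monomial \<open>x\<^sup>\<alpha>\<close> and the functional \<open>\<partial>\<^sup>\<alpha>\<close> are both represented by the exponent \<open>\<alpha>\<close> whenever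
  sets of initial terms are formed.
\<close>

type_synonym 'n monom = "'n \<Rightarrow>\<^sub>0 nat"
type_synonym 'n mpoly = "'n monom \<Rightarrow>\<^sub>0 complex"

definition var :: "'n \<Rightarrow> 'n mpoly" where
  "var i = Poly_Mapping.single (Poly_Mapping.single i 1) 1"

definition total_deg :: "'n::finite monom \<Rightarrow> nat" where
  "total_deg \<alpha> = (\<Sum>i\<in>UNIV. Poly_Mapping.lookup \<alpha> i)"

definition poly_eval :: "complex ^ 'n::finite \<Rightarrow> 'n mpoly \<Rightarrow> complex" where
  "poly_eval c p =
    (\<Sum>\<alpha>\<in>Poly_Mapping.keys p. Poly_Mapping.lookup p \<alpha> * (\<Prod>i\<in>UNIV. (c $ i) ^ Poly_Mapping.lookup \<alpha> i))"

definition linear_form :: "complex ^ 'n::finite \<Rightarrow> 'n mpoly" where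
  "linear_form c = (\<Sum>i\<in>UNIV. Poly_Mapping.single 0 (c $ i) * var i)"

definition zariski_closed :: "(complex ^ 'n::finite) set \<Rightarrow> bool" where
  "zariski_closed Z \<longleftrightarrow> (\<exists>P :: 'n mpoly set. Z = {c. \<forall>p\<in>P. poly_eval c p = 0})"

definition polys_le :: "nat \<Rightarrow> 'n::finite mpoly set" where
  "polys_le d = {g. \<forall>\<alpha>\<in>Poly_Mapping.keys g. total_deg \<alpha> \<le> d}"


section \<open>Ideals\<close>

abbreviation ideal_gen :: "'a::comm_ring_1 set \<Rightarrow> 'a set" where
  "ideal_gen F \<equiv> module.span (*) F"

abbreviation is_ideal :: "'a::comm_ring_1 set \<Rightarrow> bool" where
  "is_ideal I \<equiv> module.subspace (*) I"

definition max_ideal :: "'n::finite mpoly set" where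
  "max_ideal = ideal_gen (range var)"

primrec ideal_power :: "'a::comm_ring_1 set \<Rightarrow> nat \<Rightarrow> 'a set" where
  "ideal_power J 0 = UNIV"
| "ideal_power J (Suc k) = ideal_gen {a * b | a b. a \<in> J \<and> b \<in> ideal_power J k}"

definition colon :: "'a::comm_ring_1 set \<Rightarrow> 'a set \<Rightarrow> 'a set" where
  "colon I J = {f. \<forall>g\<in>J. f * g \<in> I}"

definition saturation :: "'a::comm_ring_1 set \<Rightarrow> 'a set \<Rightarrow> 'a set" where
  "saturation I J = (\<Union>k. colon I (ideal_power J k))"

definition is_prime_ideal :: "'a::comm_ring_1 set \<Rightarrow> bool" where
  "is_prime_ideal P \<longleftrightarrow> is_ideal P \<and> P \<noteq> UNIV \<and> (\<forall>a b. a * b \<in> P \<longrightarrow> a \<in> P \<or> b \<in> P)"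

text \<open>\<open>Ass(R/I)\<close>: the prime ideals of the form \<open>Ann(g + I)\<close>.\<close>

definition Ass :: "'a::comm_ring_1 set \<Rightarrow> 'a set set" where
  "Ass I = {P. is_prime_ideal P \<and> (\<exists>g. P = {f. f * g \<in> I})}"


section \<open>Localization at the origin\<close>

text \<open>\<open>R\<^sub>0\<close> is realized inside the fraction field of \<open>R\<close>.\<close>

definition local_ring :: "'n::{finite,linorder} mpoly fract set" where
  "local_ring = {Fract f g | f g. g \<notin> max_ideal}"

definition extension :: "'n::{finite,linorder} mpoly set \<Rightarrow> 'n mpoly fract set" where
  "extension I =
    {(\<Sum>a\<in>A. r a * Fract a 1) | A r. finite A \<and> A \<subseteq> I \<and> (\<forall>a\<in>A. r a \<in> local_ring)}"

definition contraction :: "'n::{finite,linorder} mpoly fract set \<Rightarrow> 'n mpoly set" where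
  "contraction K = {f. Fract f 1 \<in> K}"


section \<open>The dual space\<close>

definition pdiff :: "'n \<Rightarrow> 'n mpoly \<Rightarrow> 'n mpoly" where
  "pdiff i p = (\<Sum>\<alpha>\<in>Poly_Mapping.keys p.
    Poly_Mapping.single (\<alpha> - Poly_Mapping.single i 1)
      (of_nat (Poly_Mapping.lookup \<alpha> i) * Poly_Mapping.lookup p \<alpha>))"

text \<open>The partial derivatives commute; the list only fixes some order in which to take them.\<close>

definition pdiffs :: "'n::{finite,linorder} monom \<Rightarrow> 'n mpoly \<Rightarrow> 'n mpoly" where
  "pdiffs \<alpha> = fold (\<lambda>i. pdiff i ^^ Poly_Mapping.lookup \<alpha> i) (sorted_list_of_set UNIV)"

definition diff_functional :: "'n::{finite,linorder} monom \<Rightarrow> 'n mpoly \<Rightarrow> complex" where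
  "diff_functional \<alpha> g =
    poly_eval 0 (pdiffs \<alpha> g) / (\<Prod>i\<in>UNIV. fact (Poly_Mapping.lookup \<alpha> i))"

text \<open>The finite linear combination \<open>\<Sum> c\<^sub>\<alpha> \<partial>\<^sup>\<alpha>\<close> of functionals with coefficient family \<open>c\<close>.\<close>

definition diff_comb ::
  "('n::{finite,linorder} monom \<Rightarrow>\<^sub>0 complex) \<Rightarrow> 'n mpoly \<Rightarrow> complex" where
  "diff_comb c g = (\<Sum>\<alpha>\<in>Poly_Mapping.keys c. Poly_Mapping.lookup c \<alpha> * diff_functional \<alpha> g)"

definition D0 :: "('n::{finite,linorder} mpoly \<Rightarrow> complex) set" where
  "D0 = range diff_comb"

definition D0_le :: "nat \<Rightarrow> ('n::{finite,linorder} mpoly \<Rightarrow> complex) set" where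
  "D0_le k = diff_comb ` {c. \<forall>\<alpha>\<in>Poly_Mapping.keys c. total_deg \<alpha> \<le> k}"

definition dual_space :: "'n::{finite,linorder} mpoly set \<Rightarrow> ('n mpoly \<Rightarrow> complex) set" where
  "dual_space I = {q \<in> D0. \<forall>g\<in>I. q g = 0}"

definition dual_space_le ::
  "nat \<Rightarrow> 'n::{finite,linorder} mpoly set \<Rightarrow> ('n mpoly \<Rightarrow> complex) set" where
  "dual_space_le k I = dual_space I \<inter> D0_le k"

definition act :: "'n mpoly \<Rightarrow> ('n mpoly \<Rightarrow> complex) \<Rightarrow> 'n mpoly \<Rightarrow> complex" where
  "act g q = (\<lambda>f. q (g * f))"

text \<open>Well defined on \<open>D0\<close> because the \<open>\<partial>\<^sup>\<alpha>\<close> are linearly independent.\<close>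

definition diff_coeffs ::
  "('n::{finite,linorder} mpoly \<Rightarrow> complex) \<Rightarrow> 'n monom \<Rightarrow>\<^sub>0 complex" where
  "diff_coeffs q = (THE c. q = diff_comb c)"


section \<open>Orders, initial terms and s-corners\<close>

text \<open>An order is a relation \<open>r\<close> with \<open>(\<alpha>, \<beta>) \<in> r\<close> meaning \<open>x\<^sup>\<alpha> \<le> x\<^sup>\<beta>\<close>. The dual order is \<open>r\<inverse>\<close>.\<close>

definition local_monomial_order :: "'n monom rel \<Rightarrow> bool" where
  "local_monomial_order r \<longleftrightarrow>
    linear_order r \<and> (\<forall>\<alpha> \<beta> \<gamma>. (\<alpha>, \<beta>) \<in> r \<longrightarrow> (\<alpha> + \<gamma>, \<beta> + \<gamma>) \<in> r) \<and> (\<forall>\<alpha>. (\<alpha>, 0) \<in> r)"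

definition lead_exp :: "'n monom rel \<Rightarrow> ('n monom \<Rightarrow>\<^sub>0 complex) \<Rightarrow> 'n monom" where
  "lead_exp r c =
    (THE \<alpha>. \<alpha> \<in> Poly_Mapping.keys c \<and> (\<forall>\<beta>\<in>Poly_Mapping.keys c. (\<beta>, \<alpha>) \<in> r))"

definition initials :: "'n monom rel \<Rightarrow> 'n mpoly set \<Rightarrow> 'n monom set" where
  "initials r A = {lead_exp r g | g. g \<in> A \<and> g \<noteq> 0}"

definition dual_initials ::
  "'n::{finite,linorder} monom rel \<Rightarrow> ('n mpoly \<Rightarrow> complex) set \<Rightarrow> 'n monom set" where
  "dual_initials r S = {lead_exp (r\<inverse>) (diff_coeffs q) | q. q \<in> S \<and> q \<noteq> (\<lambda>_. 0)}"

definition s_corners :: "'n monom set \<Rightarrow> 'n monom set" where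
  "s_corners M = {\<alpha>. \<alpha> \<notin> M \<and> (\<forall>i. Poly_Mapping.single i 1 + \<alpha> \<in> M)}"


section \<open>The procedure\<close>

text \<open>One pass with the given \<open>d\<close>: the returned value, or \<open>None\<close> if \<open>d\<close> has to be increased.\<close>

definition pass ::
  "'n::{finite,linorder} monom rel \<Rightarrow> 'n mpoly set \<Rightarrow> 'n mpoly \<Rightarrow> nat \<Rightarrow> bool option" where
  "pass r I l d =
    (if \<not> initials r (saturation I max_ideal \<inter> polys_le d) \<subseteq> initials r I then Some True
     else if s_corners (initials r I) \<subseteq> dual_initials r (act l ` dual_space_le (d + 1) I)
       then Some False
     else None)"

text \<open>The value of the whole loop; \<open>None\<close> if it does not terminate.\<close>

definition run_procedure ::
  "'n::{finite,linorder} monom rel \<Rightarrow> 'n mpoly set \<Rightarrow> 'n mpoly \<Rightarrow> bool option" where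
  "run_procedure r I l = Option.bind (while_option (\<lambda>d. pass r I l d = None) Suc 0) (pass r I l)"

end

theory Submission
  imports Defs
begin

text \<open>
  Let \<open>I\<close> be an ideal and \<open>\<mm>\<close> the maximal ideal of the origin.  For a local order the monomials
  strictly below \<open>x\<^sup>\<alpha>\<close> are closed under multiplication by arbitrary monomials, so the polynomials
  supported on them form an ideal \<open>N\<close>, and \<open>x\<^sup>\<alpha>\<close> is an initial monomial of an ideal \<open>K\<close> iff
  \<open>x\<^sup>\<alpha> \<in> K + N\<close>.  This turns questions about initial monomials into questions about membership in
  ideals, which Krull's intersection theorem (\<open>Krull_intersection\<close>) decides modulo all powers of \<open>\<mm>\<close>.

  Suppose that \<open>\<mm>\<close> is associated, \<open>\<mm> = (I : g)\<close>.  Among the elements of \<open>g + I\<close> there is one, \<open>f\<close>,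
  whose initial monomial \<open>x\<^sup>\<beta>\<close> is not in \<open>in(I)\<close> (\<open>exists_initial_outside\<close>, by Mora's variant of
  division).  Since \<open>\<mm> f \<subseteq> I\<close>, this \<open>f\<close> lies in the saturation, so step (i) succeeds once \<open>d\<close> reaches
  its degree.  Moreover \<open>x\<^sup>\<beta>\<close> is an s-corner of \<open>in(I)\<close>, and it blocks step (ii) for every \<open>d\<close>: a
  functional \<open>l \<cdot> q\<close> with initial term \<open>\<partial>\<^sup>\<beta>\<close> does not vanish at \<open>f\<close>, whereas \<open>(l \<cdot> q)(f) = q(l f) = 0\<close>
  because \<open>l f \<in> I\<close> (\<open>not_dual_initial\<close>).

  Suppose that \<open>\<mm>\<close> is not associated.  Then \<open>I\<close> equals its saturation, so step (i) never succeeds.  A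
  linear form \<open>l\<close> outside the finitely many associated primes, none of which contains all variables, is
  a nonzerodivisor modulo \<open>I\<close>; the exceptional coefficient vectors lie on finitely many hyperplanes,
  and these do not depend on the order.  For such \<open>l\<close> and \<open>x\<^sup>\<alpha> \<notin> in(I)\<close>, Krull's theorem for \<open>I + l N\<close>
  shows \<open>l x\<^sup>\<alpha> \<notin> I + l N + \<mm>\<^sup>s\<close> for some \<open>s\<close>.  A linear functional that vanishes on the right-hand
  side but not at \<open>l x\<^sup>\<alpha>\<close> is an element \<open>q\<close> of the dual space for which \<open>l \<cdot> q\<close> has initial term
  \<open>\<partial>\<^sup>\<alpha>\<close> (\<open>dual_initial_exists\<close>).  There are only finitely many s-corners, so step (ii) succeeds for all
  large \<open>d\<close>.
\<close>

section \<open>Ideals in a commutative ring\<close>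

lemma module_mult: "module ((*) :: 'a::comm_ring_1 \<Rightarrow> 'a \<Rightarrow> 'a)"
  by unfold_locales (simp_all add: algebra_simps)

lemma is_ideal_iff:
  "is_ideal I \<longleftrightarrow> 0 \<in> I \<and> (\<forall>x\<in>I. \<forall>y\<in>I. x + y \<in> I) \<and> (\<forall>c. \<forall>x\<in>I. c * x \<in> I)"
  by (rule module.subspace_def[OF module_mult])

lemma ideal_0: "is_ideal I \<Longrightarrow> 0 \<in> I"
  and ideal_add: "is_ideal I \<Longrightarrow> x \<in> I \<Longrightarrow> y \<in> I \<Longrightarrow> x + y \<in> I"
  and ideal_mult: "is_ideal I \<Longrightarrow> x \<in> I \<Longrightarrow> c * x \<in> I"
  by (auto simp: is_ideal_iff)

lemma ideal_mult_right: "is_ideal I \<Longrightarrow> x \<in> I \<Longrightarrow> x * c \<in> I"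
  using ideal_mult[of I x c] by (simp add: mult.commute)

lemma ideal_diff: "is_ideal I \<Longrightarrow> x \<in> I \<Longrightarrow> y \<in> I \<Longrightarrow> x - y \<in> I"
  by (rule module.subspace_diff[OF module_mult])

lemma ideal_sum: "is_ideal I \<Longrightarrow> (\<And>x. x \<in> A \<Longrightarrow> f x \<in> I) \<Longrightarrow> sum f A \<in> I"
  by (rule module.subspace_sum[OF module_mult])

lemma is_ideal_gen: "is_ideal (ideal_gen S)"
  by (rule module.subspace_span[OF module_mult])

lemma ideal_gen_base: "x \<in> S \<Longrightarrow> x \<in> ideal_gen S"
  by (rule module.span_base[OF module_mult])

lemma ideal_gen_minimal: "S \<subseteq> J \<Longrightarrow> is_ideal J \<Longrightarrow> ideal_gen S \<subseteq> J"
  by (rule module.span_minimal[OF module_mult])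

lemma ideal_cong_iff: "is_ideal I \<Longrightarrow> x - y \<in> I \<Longrightarrow> x \<in> I \<longleftrightarrow> y \<in> I"
  using ideal_add[of I "x - y" y] ideal_diff[of I x "x - y"] by auto

lemma is_ideal_sum_image:
  assumes "is_ideal I" "is_ideal J"
  shows "is_ideal {i + a * j | i j. i \<in> I \<and> j \<in> J}" (is "is_ideal ?K")
  unfolding is_ideal_iff
proof (intro conjI ballI allI)
  show "0 \<in> ?K"
    using ideal_0[OF assms(1)] ideal_0[OF assms(2)] by force
next
  fix x y
  assume "x \<in> ?K" "y \<in> ?K"
  then obtain i j i' j' where "x = i + a * j" "y = i' + a * j'" "i \<in> I" "j \<in> J" "i' \<in> I" "j' \<in> J"
    by blast
  then have "x + y = (i + i') + a * (j + j')" "i + i' \<in> I" "j + j' \<in> J"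
    using assms by (auto simp: algebra_simps ideal_add)
  then show "x + y \<in> ?K"
    by blast
next
  fix c x
  assume "x \<in> ?K"
  then obtain i j where "x = i + a * j" "i \<in> I" "j \<in> J"
    by blast
  then have "c * x = c * i + a * (c * j)" "c * i \<in> I" "c * j \<in> J"
    using assms by (auto simp: algebra_simps ideal_mult)
  then show "c * x \<in> ?K"
    by blast
qed

lemma is_ideal_colon_elem:
  assumes "is_ideal I"
  shows "is_ideal {f. f * g \<in> I}"
  using assms by (auto simp: is_ideal_iff distrib_right mult.assoc)

section \<open>Associated primes of an ideal in a noetherian ring\<close>

lemma prime_ideal_mult_iff:
  "is_prime_ideal P \<Longrightarrow> a \<notin> P \<Longrightarrow> f * a \<in> P \<longleftrightarrow> f \<in> P"
  unfolding is_prime_ideal_def using ideal_mult_right[of P f a] by blast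

text \<open>The larger ideal comes first, so that well-foundedness of this relation is the ascending chain
  condition.\<close>

definition larger_ideal :: "('a::comm_ring_1 set \<times> 'a set) set" where
  "larger_ideal = {(J, I). is_ideal J \<and> is_ideal I \<and> I \<subset> J}"

lemma maximal_ideal_exists:
  assumes "wf (larger_ideal :: ('a::comm_ring_1 set \<times> 'a set) set)"
    and "K \<in> X" and ids: "\<And>J. J \<in> X \<Longrightarrow> is_ideal (J :: 'a set)"
  obtains Q where "Q \<in> X" "\<And>J. J \<in> X \<Longrightarrow> Q \<subseteq> J \<Longrightarrow> J = Q"
proof -
  obtain Q where Q: "Q \<in> X" "\<And>J. (J, Q) \<in> larger_ideal \<Longrightarrow> J \<notin> X"
    using wfE_min[OF assms(1,2)] by blast
  have "J = Q" if "J \<in> X" "Q \<subseteq> J" for J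
    using Q(2)[of J] that ids[OF that(1)] ids[OF Q(1)] by (auto simp: larger_ideal_def)
  with Q(1) show ?thesis
    using that by blast
qed

text \<open>A maximal annihilator among those that contain \<open>l\<close> is prime.\<close>

lemma zero_divisor_in_Ass:
  fixes I :: "'a::comm_ring_1 set"
  assumes noeth: "wf (larger_ideal :: ('a set \<times> 'a set) set)" and I: "is_ideal I"
    and "g \<notin> I" "l * g \<in> I"
  obtains P where "P \<in> Ass I" "l \<in> P"
proof -
  define X where "X = {{f. f * h \<in> I} | h. h \<notin> I \<and> l * h \<in> I}"
  have "{f. f * g \<in> I} \<in> X"
    using assms by (auto simp: X_def)
  then obtain P where P: "P \<in> X" "\<And>J. J \<in> X \<Longrightarrow> P \<subseteq> J \<Longrightarrow> J = P"
    by (rule maximal_ideal_exists[OF noeth]) (auto simp: X_def is_ideal_colon_elem[OF I])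
  from P(1) obtain h where h: "P = {f. f * h \<in> I}" "h \<notin> I" "l * h \<in> I"
    by (auto simp: X_def)
  have "a \<in> P \<or> b \<in> P" if ab: "a * b \<in> P" for a b
  proof (rule disjCI)
    assume b: "b \<notin> P"
    have "{f. f * (b * h) \<in> I} = P"
    proof (rule P(2))
      show "{f. f * (b * h) \<in> I} \<in> X"
        using b h ideal_mult[OF I h(3), of b] by (auto simp: X_def mult.left_commute)
      show "P \<subseteq> {f. f * (b * h) \<in> I}"
        using ideal_mult[OF I, of _ b] by (auto simp: h mult.left_commute[of _ b])
    qed
    moreover have "a \<in> {f. f * (b * h) \<in> I}"
      using ab by (simp add: h mult.assoc)
    ultimately show "a \<in> P"
      by simp
  qed
  moreover have "1 \<notin> P"
    using h(1,2) by simp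
  then have "P \<noteq> UNIV"
    by blast
  moreover have "is_ideal P"
    unfolding h(1) by (rule is_ideal_colon_elem[OF I])
  ultimately have "is_prime_ideal P"
    by (simp add: is_prime_ideal_def)
  with h show ?thesis
    by (intro that[of P]) (auto simp: Ass_def)
qed

text \<open>If \<open>P = (I : g)\<close> is prime, then an associated prime \<open>(I : h)\<close> of \<open>I\<close> other than \<open>P\<close> is one
  of \<open>I + (g)\<close>: a nonzero common multiple of \<open>g\<close> and \<open>h\<close> modulo \<open>I\<close> would have both annihilators.
  So the associated primes can be split off one at a time.\<close>

lemma finite_Ass:
  fixes I :: "'a::comm_ring_1 set"
  assumes noeth: "wf (larger_ideal :: ('a set \<times> 'a set) set)" and "is_ideal I"
  shows "finite (Ass I)"
  using assms(2)
proof (induction I rule: wf_induct_rule[OF noeth])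
  case (1 I)
  note I = \<open>is_ideal I\<close>
  show ?case
  proof (cases "Ass I = {}")
    case False
    then obtain P g where P: "is_prime_ideal P" "P = {f. f * g \<in> I}"
      by (auto simp: Ass_def)
    have g: "g \<notin> I"
    proof
      assume "g \<in> I"
      then have "P = UNIV"
        using P(2) ideal_mult[OF I] by auto
      with P(1) show False
        by (simp add: is_prime_ideal_def)
    qed
    define J where "J = {i + g * j | i j. i \<in> I \<and> j \<in> UNIV}"
    have J: "is_ideal J"
      unfolding J_def by (rule is_ideal_sum_image[OF I]) (simp add: is_ideal_iff)
    have "I \<subseteq> J"
    proof
      fix x assume "x \<in> I"
      moreover have "x = x + g * 0" by simp
      ultimately show "x \<in> J" unfolding J_def by blast
    qed
    moreover have "g \<in> J"
    proof -
      have "g = 0 + g * 1" by simp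
      with ideal_0[OF I] show ?thesis unfolding J_def by blast
    qed
    ultimately have "(J, I) \<in> larger_ideal"
      using I J g by (auto simp: larger_ideal_def)
    then have "finite (Ass J)"
      using 1 J by blast
    moreover have "Ass I \<subseteq> insert P (Ass J)"
    proof
      fix P'
      assume "P' \<in> Ass I"
      then obtain h where P': "is_prime_ideal P'" "P' = {f. f * h \<in> I}"
        by (auto simp: Ass_def)
      show "P' \<in> insert P (Ass J)"
      proof (cases "\<forall>f. f * h \<in> J \<longrightarrow> f * h \<in> I")
        case True
        then have "P' = {f. f * h \<in> J}"
          using P'(2) \<open>I \<subseteq> J\<close> by auto
        with P'(1) show ?thesis
          by (auto simp: Ass_def)
      next
        case False
        then obtain a i b where ab: "a * h = i + g * b" "i \<in> I" "a * h \<notin> I"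
          by (auto simp: J_def)
        have "b * g \<notin> I"
          using ab ideal_add[OF I] by (auto simp: mult.commute)
        have "f \<in> P' \<longleftrightarrow> f \<in> P" for f
        proof -
          have "f \<in> P' \<longleftrightarrow> f * a \<in> P'"
            by (rule prime_ideal_mult_iff[symmetric, OF P'(1)]) (use P'(2) ab(3) in auto)
          also have "\<dots> \<longleftrightarrow> f * (a * h) \<in> I"
            by (simp add: P'(2) mult.assoc)
          also have "\<dots> \<longleftrightarrow> f * (b * g) \<in> I"
            using ideal_cong_iff[OF I, of "f * (a * h)" "f * (b * g)"] ideal_mult[OF I ab(2), of f]
            by (simp add: ab(1) algebra_simps)
          also have "\<dots> \<longleftrightarrow> f * b \<in> P"
            by (simp add: P(2) mult.assoc)
          also have "\<dots> \<longleftrightarrow> f \<in> P"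
            by (rule prime_ideal_mult_iff[OF P(1)]) (use P(2) \<open>b * g \<notin> I\<close> in auto)
          finally show ?thesis .
        qed
        then show ?thesis
          by blast
      qed
    qed
    ultimately show ?thesis
      using finite_subset by auto
  qed simp
qed


section \<open>Dickson's lemma\<close>

text \<open>One coordinate at a time: a sequence of natural numbers has a monotone subsequence, obtained by
  moving on to a place where the rest of the sequence takes its least value.\<close>

lemma Dickson_subsequence:
  fixes a :: "nat \<Rightarrow> 'i \<Rightarrow> nat"
  assumes "finite S"
  shows "\<exists>\<phi>::nat \<Rightarrow> nat. strict_mono \<phi> \<and> (\<forall>k\<in>S. mono (\<lambda>n. a (\<phi> n) k))"
  using assms
proof (induction S)
  case empty
  then show ?case
    by (intro exI[of _ id]) (auto simp: strict_mono_def)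
next
  case (insert k S)
  then obtain \<phi> :: "nat \<Rightarrow> nat" where \<phi>: "strict_mono \<phi>" "\<And>k. k \<in> S \<Longrightarrow> mono (\<lambda>n. a (\<phi> n) k)"
    by blast
  define b where "b n = a (\<phi> n) k" for n
  \<comment> \<open>The index of a smallest entry among those from \<open>n\<close> on.\<close>
  define m where "m n = (ARG_MIN b i. n \<le> i)" for n
  have m: "n \<le> m n" "n \<le> i \<Longrightarrow> b (m n) \<le> b i" for n i
    unfolding m_def
    by (rule arg_min_natI[of "(\<le>) n" n], simp) (rule arg_min_nat_le)
  define \<psi> where "\<psi> n = ((\<lambda>i. m (Suc i)) ^^ n) (m 0)" for n
  have \<psi>: "\<psi> 0 = m 0" "\<psi> (Suc n) = m (Suc (\<psi> n))" for n
    by (simp_all add: \<psi>_def)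
  have psi_mono: "strict_mono \<psi>"
    unfolding strict_mono_Suc_iff \<psi> using m(1) Suc_le_lessD by blast
  have "b (\<psi> n) \<le> b (\<psi> (Suc n))" for n
  proof (cases n)
    case 0
    then show ?thesis
      by (metis \<psi>(1) le0 m(2))
  next
    case (Suc j)
    have "Suc (\<psi> j) \<le> \<psi> (Suc n)"
      using psi_mono Suc by (metis Suc_leI lessI less_SucI strict_mono_less)
    then show ?thesis
      using m(2)[of "Suc (\<psi> j)"] by (simp add: Suc \<psi>(2))
  qed
  then have "mono (\<lambda>n. a (\<phi> (\<psi> n)) k)"
    unfolding b_def[symmetric] by (intro mono_iff_le_Suc[THEN iffD2]) blast
  moreover have "mono (\<lambda>n. a (\<phi> (\<psi> n)) i)" if "i \<in> S" for i
    using \<phi>(2)[OF that] strict_mono_mono[OF psi_mono] by (simp add: mono_def)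
  ultimately show ?case
    using strict_mono_o[OF \<phi>(1) psi_mono]
    by (intro exI[of _ "\<phi> \<circ> \<psi>"]) (auto simp: o_def)
qed

lemma Dickson_pair:
  fixes a :: "nat \<Rightarrow> 'i::finite \<Rightarrow> nat"
  obtains i j where "i < j" "\<And>k. a i k \<le> a j k"
proof -
  obtain \<phi> :: "nat \<Rightarrow> nat" where \<phi>: "strict_mono \<phi>" "\<And>k. mono (\<lambda>n. a (\<phi> n) k)"
    using Dickson_subsequence[of UNIV a] by auto
  show ?thesis
    using \<phi> by (intro that[of "\<phi> 0" "\<phi> 1"]) (auto simp: strict_mono_def mono_def)
qed

text \<open>A greedy choice of elements of \<open>X\<close> above none of the previous ones would give a sequence
  without a comparable pair.  The vectors are attached to the elements by \<open>e\<close> rather than being the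
  elements themselves, so that polynomials can be compared by a degree together with an exponent.\<close>

lemma Dickson_finite_basis:
  fixes e :: "'a \<Rightarrow> 'i::finite \<Rightarrow> nat"
  obtains X0 where "finite X0" "X0 \<subseteq> X" "\<And>x. x \<in> X \<Longrightarrow> \<exists>y\<in>X0. \<forall>k. e y k \<le> e x k"
proof (rule ccontr)
  assume "\<not> thesis"
  then have neg: "\<And>X0. \<lbrakk>finite X0; X0 \<subseteq> X; \<And>x. x \<in> X \<Longrightarrow> \<exists>y\<in>X0. \<forall>k. e y k \<le> e x k\<rbrakk> \<Longrightarrow> False"
    using that by blast
  have ex: "\<exists>x. x \<in> X \<and> (\<forall>y\<in>X0. \<not> (\<forall>k. e y k \<le> e x k))" if "finite X0" "X0 \<subseteq> X" for X0
    using neg[OF that] by blast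
  define c where "c X0 = (SOME x. x \<in> X \<and> (\<forall>y\<in>X0. \<not> (\<forall>k. e y k \<le> e x k)))" for X0
  have c: "c X0 \<in> X" "\<And>y. y \<in> X0 \<Longrightarrow> \<not> (\<forall>k. e y k \<le> e (c X0) k)"
    if "finite X0" "X0 \<subseteq> X" for X0
    using someI_ex[OF ex[OF that]] unfolding c_def by blast+
  define B where "B n = ((\<lambda>Y. insert (c Y) Y) ^^ n) {}" for n
  have B_Suc: "B (Suc n) = insert (c (B n)) (B n)" for n
    by (simp add: B_def)
  have B: "finite (B n) \<and> B n \<subseteq> X" for n
    by (induction n) (use c in \<open>auto simp: B_Suc B_def\<close>)
  have B_mono: "B i \<subseteq> B j" if "i \<le> j" for i j
    using that by (rule lift_Suc_mono_le[rotated]) (auto simp: B_Suc)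
  obtain i j where ij: "i < j" "\<And>k. e (c (B i)) k \<le> e (c (B j)) k"
    using Dickson_pair[of "\<lambda>n. e (c (B n))"] by blast
  have "c (B i) \<in> B j"
    using B_mono[of "Suc i" j] ij(1) by (auto simp: B_Suc)
  with c(2)[of "B j"] B ij(2) show False
    by blast
qed

section \<open>Polynomials and monomial ideals\<close>

abbreviation monomial :: "'n monom \<Rightarrow> 'n mpoly" where
  "monomial \<alpha> \<equiv> Poly_Mapping.single \<alpha> 1"

lemma lookup_single_mult:
  fixes p :: "'n mpoly"
  shows "Poly_Mapping.lookup (Poly_Mapping.single \<alpha> c * p) (\<alpha> + \<beta>) = c * Poly_Mapping.lookup p \<beta>"
  by (simp add: lookup_mult lookup_single when_mult)

lemma lookup_scale:
  fixes p :: "'n mpoly"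
  shows "Poly_Mapping.lookup (Poly_Mapping.single 0 c * p) \<beta> = c * Poly_Mapping.lookup p \<beta>"
  using lookup_single_mult[of 0 c p \<beta>] by simp

lemma keys_mpoly_mult:
  fixes p q :: "'n mpoly"
  assumes "\<gamma> \<in> Poly_Mapping.keys (p * q)"
  obtains \<alpha> \<beta> where "\<alpha> \<in> Poly_Mapping.keys p" "\<beta> \<in> Poly_Mapping.keys q" "\<gamma> = \<alpha> + \<beta>"
  using keys_mult[of p q] assms by blast

lemma keys_single_mult:
  fixes p :: "'n mpoly"
  assumes "c \<noteq> 0"
  shows "Poly_Mapping.keys (Poly_Mapping.single \<alpha> c * p) = (+) \<alpha> ` Poly_Mapping.keys p"
proof
  show "Poly_Mapping.keys (Poly_Mapping.single \<alpha> c * p) \<subseteq> (+) \<alpha> ` Poly_Mapping.keys p"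
    using assms by (auto elim!: keys_mpoly_mult)
  show "(+) \<alpha> ` Poly_Mapping.keys p \<subseteq> Poly_Mapping.keys (Poly_Mapping.single \<alpha> c * p)"
    using assms by (auto simp: in_keys_iff lookup_single_mult)
qed

lemma sum_monomials:
  fixes p :: "'n mpoly"
  shows "p = (\<Sum>\<alpha>\<in>Poly_Mapping.keys p. Poly_Mapping.single \<alpha> (Poly_Mapping.lookup p \<alpha>))"
  by (rule poly_mapping_eqI)
    (auto simp: lookup_sum lookup_single when_def in_keys_iff)

lemma monom_add_diff:
  fixes \<alpha> \<beta> :: "'n monom"
  assumes "\<And>k. Poly_Mapping.lookup \<alpha> k \<le> Poly_Mapping.lookup \<beta> k"
  shows "\<beta> = (\<beta> - \<alpha>) + \<alpha>"
  using assms by (intro poly_mapping_eqI) (simp add: lookup_add lookup_minus)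

lemma total_deg_add: "total_deg (\<alpha> + \<beta>) = total_deg \<alpha> + total_deg \<beta>"
  by (simp add: total_deg_def lookup_add sum.distrib)

lemma total_deg_0_iff: "total_deg \<alpha> = 0 \<longleftrightarrow> \<alpha> = 0"
  by (auto simp: total_deg_def intro: poly_mapping_eqI)

lemma finite_total_deg_le: "finite {\<alpha> :: 'n::finite monom. total_deg \<alpha> \<le> d}"
proof -
  have "Poly_Mapping.lookup \<alpha> i \<le> total_deg \<alpha>" for \<alpha> :: "'n monom" and i
    unfolding total_deg_def by (rule member_le_sum) auto
  then have "Poly_Mapping.lookup ` {\<alpha> :: 'n monom. total_deg \<alpha> \<le> d} \<subseteq> PiE UNIV (\<lambda>_. {..d})"
    by (auto simp: PiE_UNIV_domain intro: order_trans)
  then have "finite (Poly_Mapping.lookup ` {\<alpha> :: 'n monom. total_deg \<alpha> \<le> d})"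
    by (rule finite_subset) (auto intro: finite_PiE)
  then show ?thesis
    by (rule finite_imageD) (auto simp: inj_on_def)
qed

definition monomial_ideal :: "'n monom set \<Rightarrow> 'n mpoly set" where
  "monomial_ideal U = {p. Poly_Mapping.keys p \<subseteq> U}"

lemma is_ideal_monomial_ideal:
  assumes "\<And>\<alpha> \<gamma>. \<alpha> \<in> U \<Longrightarrow> \<gamma> + \<alpha> \<in> U"
  shows "is_ideal (monomial_ideal U)"
  unfolding is_ideal_iff
proof (intro conjI ballI allI)
  show "0 \<in> monomial_ideal U"
    by (simp add: monomial_ideal_def)
next
  fix p q :: "'a mpoly"
  assume "p \<in> monomial_ideal U" "q \<in> monomial_ideal U"
  then show "p + q \<in> monomial_ideal U"
    using keys_add[of p q] by (auto simp: monomial_ideal_def)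
next
  fix p q :: "'a mpoly"
  assume "q \<in> monomial_ideal U"
  then show "p * q \<in> monomial_ideal U"
    using assms by (auto simp: monomial_ideal_def elim!: keys_mpoly_mult)
qed

definition max_ideal_power :: "nat \<Rightarrow> 'n::finite mpoly set" where
  "max_ideal_power s = monomial_ideal {\<alpha>. s \<le> total_deg \<alpha>}"

lemma is_ideal_max_ideal_power: "is_ideal (max_ideal_power s)"
  unfolding max_ideal_power_def by (rule is_ideal_monomial_ideal) (simp add: total_deg_add)

lemma var_in_max_ideal: "var i \<in> max_ideal"
  unfolding max_ideal_def by (rule ideal_gen_base) simp

lemma max_ideal_eq: "(max_ideal :: 'n::finite mpoly set) = monomial_ideal (- {0})"
proof
  have "is_ideal (monomial_ideal (- {0 :: 'n monom}))"
    by (rule is_ideal_monomial_ideal) (auto simp: total_deg_0_iff[symmetric] total_deg_add)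
  moreover have "range var \<subseteq> monomial_ideal (- {0 :: 'n monom})"
    by (auto simp: var_def monomial_ideal_def total_deg_0_iff[symmetric] total_deg_def lookup_single when_def)
  ultimately show "max_ideal \<subseteq> monomial_ideal (- {0 :: 'n monom})"
    unfolding max_ideal_def by (rule ideal_gen_minimal[rotated])
next
  show "monomial_ideal (- {0}) \<subseteq> (max_ideal :: 'n mpoly set)"
  proof
    fix p :: "'n mpoly"
    assume p: "p \<in> monomial_ideal (- {0})"
    have ideal: "is_ideal (max_ideal :: 'n mpoly set)"
      unfolding max_ideal_def by (rule is_ideal_gen)
    have "Poly_Mapping.single \<alpha> c \<in> max_ideal" if nz: "\<alpha> \<noteq> 0" for \<alpha> :: "'n monom" and c
    proof -
      obtain i where "Poly_Mapping.lookup \<alpha> i \<noteq> 0"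
        using nz by (metis poly_mapping_eqI lookup_zero)
      then have "\<alpha> = (\<alpha> - Poly_Mapping.single i 1) + Poly_Mapping.single i 1"
        by (intro monom_add_diff) (auto simp: lookup_single when_def)
      then have "Poly_Mapping.single \<alpha> c = Poly_Mapping.single (\<alpha> - Poly_Mapping.single i 1) c * var i"
        by (simp add: var_def mult_single)
      then show ?thesis
        using ideal_mult[OF ideal var_in_max_ideal] by simp
    qed
    moreover have "\<alpha> \<noteq> 0" if "\<alpha> \<in> Poly_Mapping.keys p" for \<alpha>
      using p that by (auto simp: monomial_ideal_def)
    ultimately have "(\<Sum>\<alpha>\<in>Poly_Mapping.keys p. Poly_Mapping.single \<alpha> (Poly_Mapping.lookup p \<alpha>)) \<in> max_ideal"
      by (intro ideal_sum[OF ideal]) blast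
    then show "p \<in> max_ideal"
      by (simp add: sum_monomials[symmetric])
  qed
qed

lemma is_ideal_max_ideal: "is_ideal (max_ideal :: 'n::finite mpoly set)"
  unfolding max_ideal_def by (rule is_ideal_gen)

lemma max_ideal_iff: "p \<in> max_ideal \<longleftrightarrow> Poly_Mapping.lookup p 0 = 0"
  by (auto simp: max_ideal_eq monomial_ideal_def in_keys_iff)

text \<open>Modulo the maximal ideal, a polynomial is its constant term, which is a unit unless it is zero.\<close>

lemma max_ideal_maximal:
  assumes P: "is_ideal P" "P \<noteq> UNIV" "max_ideal \<subseteq> P"
  shows "P = (max_ideal :: 'n::finite mpoly set)"
proof (rule antisym[OF _ P(3)], rule subsetI, rule ccontr)
  fix p
  assume p: "p \<in> P" "p \<notin> (max_ideal :: 'n mpoly set)"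
  define c where "c = Poly_Mapping.lookup p 0"
  have c: "c \<noteq> 0"
    using p(2) by (simp add: max_ideal_iff c_def)
  have "p - Poly_Mapping.single 0 c \<in> max_ideal"
    by (simp add: max_ideal_iff lookup_minus c_def)
  then have "p - (p - Poly_Mapping.single 0 c) \<in> P"
    using p(1) P by (blast intro: ideal_diff)
  then have "Poly_Mapping.single 0 (1 / c) * Poly_Mapping.single 0 c \<in> P"
    using ideal_mult[OF P(1)] by simp
  then have "1 \<in> P"
    using c by (simp add: mult_single)
  then have "UNIV \<subseteq> P"
    using ideal_mult[OF P(1), of 1] by (metis mult_1_right subsetI)
  with P(2) show False
    by blast
qed

section \<open>Initial monomials\<close>

definition monomial_order :: "'n monom rel \<Rightarrow> bool" where
  "monomial_order r \<longleftrightarrow>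
    linear_order r \<and> (\<forall>\<alpha> \<beta> \<gamma>. (\<alpha>, \<beta>) \<in> r \<longrightarrow> (\<alpha> + \<gamma>, \<beta> + \<gamma>) \<in> r)"

lemma monomial_order_linear: "monomial_order r \<Longrightarrow> linear_order r"
  by (simp add: monomial_order_def)

lemma monomial_order_add: "monomial_order r \<Longrightarrow> (\<alpha>, \<beta>) \<in> r \<Longrightarrow> (\<gamma> + \<alpha>, \<gamma> + \<beta>) \<in> r"
  by (simp add: monomial_order_def add.commute[of \<gamma>])

lemma linear_orderD:
  assumes "linear_order r"
  shows "(\<alpha>, \<alpha>) \<in> r" "(\<alpha>, \<beta>) \<in> r \<Longrightarrow> (\<beta>, \<gamma>) \<in> r \<Longrightarrow> (\<alpha>, \<gamma>) \<in> r"
    "(\<alpha>, \<beta>) \<in> r \<Longrightarrow> (\<beta>, \<alpha>) \<in> r \<Longrightarrow> \<alpha> = \<beta>" "(\<alpha>, \<beta>) \<notin> r \<Longrightarrow> (\<beta>, \<alpha>) \<in> r"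
proof -
  have "refl r" "trans r" "antisym r" "total r"
    using assms by (simp_all add: linear_order_on_def partial_order_on_def preorder_on_def)
  then show "(\<alpha>, \<alpha>) \<in> r" "(\<alpha>, \<beta>) \<in> r \<Longrightarrow> (\<beta>, \<gamma>) \<in> r \<Longrightarrow> (\<alpha>, \<gamma>) \<in> r"
    "(\<alpha>, \<beta>) \<in> r \<Longrightarrow> (\<beta>, \<alpha>) \<in> r \<Longrightarrow> \<alpha> = \<beta>"
    by (auto dest: reflD transD antisymD)
  show "(\<alpha>, \<beta>) \<notin> r \<Longrightarrow> (\<beta>, \<alpha>) \<in> r"
    using \<open>total r\<close> \<open>refl r\<close> by (cases "\<alpha> = \<beta>") (auto simp: total_on_def dest: reflD)
qed

lemma finite_greatest:
  assumes r: "linear_order r" and "finite S" "S \<noteq> {}"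
  shows "\<exists>\<alpha>\<in>S. \<forall>\<beta>\<in>S. (\<beta>, \<alpha>) \<in> r"
  using assms(2,3)
proof (induction rule: finite_ne_induct)
  case (singleton x)
  then show ?case
    using linear_orderD(1)[OF r] by simp
next
  case (insert x S)
  then obtain \<alpha> where \<alpha>: "\<alpha> \<in> S" "\<forall>\<beta>\<in>S. (\<beta>, \<alpha>) \<in> r"
    by blast
  show ?case
  proof (cases "(x, \<alpha>) \<in> r")
    case True
    with \<alpha> show ?thesis
      by blast
  next
    case False
    then have "(\<alpha>, x) \<in> r"
      by (rule linear_orderD(4)[OF r])
    then have "\<forall>\<beta>\<in>insert x S. (\<beta>, x) \<in> r"
      using \<alpha>(2) linear_orderD(1,2)[OF r] by blast
    then show ?thesis
      by blast
  qed
qed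

definition is_lead :: "'n monom rel \<Rightarrow> ('n monom \<Rightarrow>\<^sub>0 complex) \<Rightarrow> 'n monom \<Rightarrow> bool" where
  "is_lead r f \<alpha> \<longleftrightarrow>
    \<alpha> \<in> Poly_Mapping.keys f \<and> (\<forall>\<beta>\<in>Poly_Mapping.keys f. (\<beta>, \<alpha>) \<in> r)"

lemma is_lead_iff:
  assumes r: "linear_order r" and "f \<noteq> 0"
  shows "is_lead r f \<alpha> \<longleftrightarrow> lead_exp r f = \<alpha>"
proof -
  obtain \<beta> where \<beta>: "is_lead r f \<beta>"
    using finite_greatest[OF r, of "Poly_Mapping.keys f"] assms(2) by (auto simp: is_lead_def)
  have unique: "\<gamma> = \<gamma>'" if "is_lead r f \<gamma>" "is_lead r f \<gamma>'" for \<gamma> \<gamma>'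
    using that linear_orderD(3)[OF r] by (simp add: is_lead_def)
  have "lead_exp r f = \<beta>"
    unfolding lead_exp_def is_lead_def[symmetric] by (rule the_equality[where P = "is_lead r f", OF \<beta> unique[OF _ \<beta>]])
  then show ?thesis
    using \<beta> unique by metis
qed

lemma initials_iff:
  assumes "linear_order r"
  shows "\<alpha> \<in> initials r A \<longleftrightarrow> (\<exists>f\<in>A. is_lead r f \<alpha>)"
proof -
  have "\<alpha> = lead_exp r f \<and> f \<noteq> 0 \<longleftrightarrow> is_lead r f \<alpha>" for f
    using is_lead_iff[OF assms, of f \<alpha>] by (cases "f = 0") (auto simp: is_lead_def)
  then show ?thesis
    unfolding initials_def by auto
qed

lemma is_lead_monomial_mult:
  assumes "monomial_order r" "is_lead r f \<alpha>"
  shows "is_lead r (monomial \<gamma> * f) (\<gamma> + \<alpha>)"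
  unfolding is_lead_def keys_single_mult[OF one_neq_zero]
proof (intro conjI ballI)
  show "\<gamma> + \<alpha> \<in> (+) \<gamma> ` Poly_Mapping.keys f"
    using assms(2) by (simp add: is_lead_def)
next
  fix \<beta>
  assume "\<beta> \<in> (+) \<gamma> ` Poly_Mapping.keys f"
  then obtain \<delta> where "\<delta> \<in> Poly_Mapping.keys f" "\<beta> = \<gamma> + \<delta>"
    by blast
  then show "(\<beta>, \<gamma> + \<alpha>) \<in> r"
    using assms(2) monomial_order_add[OF assms(1), of \<delta> \<alpha> \<gamma>] by (simp add: is_lead_def)
qed

lemma initials_add:
  assumes "monomial_order r" "is_ideal I" "\<alpha> \<in> initials r I"
  shows "\<gamma> + \<alpha> \<in> initials r I"
proof -
  note lin = initials_iff[OF monomial_order_linear[OF assms(1)]]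
  obtain f where "f \<in> I" "is_lead r f \<alpha>"
    using assms(3) by (auto simp: lin)
  then have "is_lead r (monomial \<gamma> * f) (\<gamma> + \<alpha>)" "monomial \<gamma> * f \<in> I"
    using assms by (auto intro: is_lead_monomial_mult ideal_mult)
  then show ?thesis
    unfolding lin by blast
qed

definition strictly_below :: "'n monom rel \<Rightarrow> 'n monom \<Rightarrow> 'n monom set" where
  "strictly_below r \<alpha> = {\<beta>. (\<beta>, \<alpha>) \<in> r \<and> \<beta> \<noteq> \<alpha>}"

lemma cancel_lead:
  assumes "is_lead r f \<alpha>" "is_lead r h \<alpha>"
  obtains c where "Poly_Mapping.keys (f - Poly_Mapping.single 0 c * h) \<subseteq> strictly_below r \<alpha>"
proof
  define c where "c = Poly_Mapping.lookup f \<alpha> / Poly_Mapping.lookup h \<alpha>"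
  define g where "g = f - Poly_Mapping.single 0 c * h"
  have g: "Poly_Mapping.lookup g \<beta> = Poly_Mapping.lookup f \<beta> - c * Poly_Mapping.lookup h \<beta>" for \<beta>
    by (simp add: g_def lookup_minus lookup_scale)
  have "Poly_Mapping.lookup g \<alpha> = 0"
    using assms by (simp add: g c_def is_lead_def in_keys_iff)
  moreover have "\<beta> \<in> Poly_Mapping.keys f \<union> Poly_Mapping.keys h" if "\<beta> \<in> Poly_Mapping.keys g" for \<beta>
    using that by (auto simp: in_keys_iff g)
  ultimately show "Poly_Mapping.keys (f - Poly_Mapping.single 0 c * h) \<subseteq> strictly_below r \<alpha>"
    using assms unfolding g_def[symmetric] is_lead_def strictly_below_def
    by (auto simp: in_keys_iff)
qed

section \<open>The polynomial ring is noetherian\<close>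

lemma monom_nonneg: "(0 :: 'n::linorder monom) \<le> \<gamma>"
proof (rule leI, rule notI)
  assume "\<gamma> < 0"
  then show False
    by (auto simp: less_poly_mapping.rep_eq less_fun_def)
qed

lemma Dickson_monom_pair:
  fixes a :: "nat \<Rightarrow> 'n::finite monom"
  obtains i j \<gamma> where "i < j" "a j = \<gamma> + a i"
proof -
  obtain i j where "i < j" "\<And>k. Poly_Mapping.lookup (a i) k \<le> Poly_Mapping.lookup (a j) k"
    using Dickson_pair[of "\<lambda>n. Poly_Mapping.lookup (a n)"] by blast
  with that show ?thesis
    using monom_add_diff by blast
qed

lemma wf_monom_less: "wf {(\<alpha> :: 'n::{finite,linorder} monom, \<beta>). \<alpha> < \<beta>}"
  unfolding wf_iff_no_infinite_down_chain
proof (rule notI, elim exE)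
  fix f :: "nat \<Rightarrow> 'n monom"
  assume "\<forall>i. (f (Suc i), f i) \<in> {(\<alpha>, \<beta>). \<alpha> < \<beta>}"
  then have f: "f (Suc i) < f i" for i
    by simp
  obtain i j \<gamma> where ij: "i < j" "f j = \<gamma> + f i"
    by (rule Dickson_monom_pair)
  have "f j < f i"
    using ij(1) f by (induction rule: less_Suc_induct) auto
  moreover have "f i \<le> f j"
    using add_right_mono[OF monom_nonneg, of "f i" \<gamma>] by (simp add: ij(2))
  ultimately show False
    by simp
qed

definition lex_order :: "'n::linorder monom rel" where
  "lex_order = {(\<alpha>, \<beta>). \<alpha> \<le> \<beta>}"

lemma monomial_order_lex_order: "monomial_order lex_order"
proof -
  have "refl lex_order" "trans lex_order" "antisym lex_order" "total lex_order"
    by (auto simp: lex_order_def intro: reflI transI antisymI totalI)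
  then show ?thesis
    by (simp add: monomial_order_def linear_order_on_def partial_order_on_def preorder_on_def)
      (simp add: lex_order_def add_right_mono)
qed

text \<open>Division by \<open>I\<close> terminates for a well-order: subtracting a multiple of an element of \<open>I\<close> with
  the same initial monomial leads to a smaller initial monomial and does not change membership.\<close>

lemma ideal_subset_if_initials:
  fixes I J :: "'n::{finite,linorder} mpoly set"
  assumes I: "is_ideal I" and J: "is_ideal J" and "I \<subseteq> J"
    and init: "initials lex_order J \<subseteq> initials lex_order I"
  shows "J \<subseteq> I"
proof
  note lin = monomial_order_linear[OF monomial_order_lex_order]
  fix f
  assume "f \<in> J"
  have "f \<in> I" if "is_lead lex_order f \<alpha>" "f \<in> J" for \<alpha> f
    using that
  proof (induction \<alpha> arbitrary: f rule: wf_induct_rule[OF wf_monom_less])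
    case (1 \<alpha>)
    then have "\<alpha> \<in> initials lex_order J"
      by (auto simp: initials_iff[OF lin])
    then have "\<alpha> \<in> initials lex_order I"
      using init by blast
    then obtain h where h: "h \<in> I" "is_lead lex_order h \<alpha>"
      by (auto simp: initials_iff[OF lin])
    obtain c where
      c: "Poly_Mapping.keys (f - Poly_Mapping.single 0 c * h) \<subseteq> strictly_below lex_order \<alpha>"
      using cancel_lead[OF 1(2) h(2)] .
    define g where "g = f - Poly_Mapping.single 0 c * h"
    have ch: "Poly_Mapping.single 0 c * h \<in> I"
      using h I by (simp add: ideal_mult)
    have "g \<in> I"
    proof (cases "g = 0")
      case True
      then show ?thesis
        using ideal_0[OF I] by simp
    next
      case False
      then have lead: "is_lead lex_order g (lead_exp lex_order g)"
        by (simp add: is_lead_iff[OF lin])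
      then have "lead_exp lex_order g < \<alpha>"
        using c by (auto simp: is_lead_def g_def strictly_below_def lex_order_def)
      moreover have "g \<in> J"
        using 1(3) ch \<open>I \<subseteq> J\<close> J by (auto simp: g_def intro: ideal_diff)
      ultimately show ?thesis
        using 1(1)[of "lead_exp lex_order g" g] lead by simp
    qed
    then show ?case
      using ideal_add[OF I _ ch, of g] by (simp add: g_def)
  qed
  with \<open>f \<in> J\<close> show "f \<in> I"
    using is_lead_iff[OF lin, of f] ideal_0[OF I] by blast
qed

text \<open>Hilbert's basis theorem.  Each proper step of a chain of ideals contributes a new initial monomial;
  Dickson's lemma makes one of these a multiple of an earlier one.\<close>

theorem noetherian_mpoly: "wf (larger_ideal :: ('n::{finite,linorder} mpoly set \<times> _) set)"
  unfolding wf_iff_no_infinite_down_chain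
proof (rule notI, elim exE)
  fix I :: "nat \<Rightarrow> 'n mpoly set"
  assume "\<forall>i. (I (Suc i), I i) \<in> larger_ideal"
  then have I: "is_ideal (I i)" "I i \<subset> I (Suc i)" for i
    by (auto simp: larger_ideal_def)
  have "\<exists>\<alpha>. \<alpha> \<in> initials lex_order (I (Suc i)) - initials lex_order (I i)" for i
    using ideal_subset_if_initials[of "I i" "I (Suc i)"] I(1) I(2)[of i] by blast
  then obtain a where a: "a i \<in> initials lex_order (I (Suc i)) - initials lex_order (I i)" for i
    by metis
  obtain i j \<gamma> where ij: "i < j" "a j = \<gamma> + a i"
    by (rule Dickson_monom_pair)
  have "I (Suc i) \<subseteq> I j"
    by (rule lift_Suc_mono_le[of I, OF psubset_imp_subset[OF I(2)]]) (use ij(1) in simp)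
  then have "a i \<in> initials lex_order (I j)"
    using a[of i] unfolding initials_def by blast
  then have "a j \<in> initials lex_order (I j)"
    using initials_add[OF monomial_order_lex_order I(1)] ij(2) by simp
  with a[of j] show False
    by blast
qed

section \<open>Krull's intersection theorem at the origin\<close>

text \<open>If \<open>b\<close> is not in \<open>K + \<mm>b\<close>, take an ideal \<open>Q\<close> above \<open>K + \<mm>b\<close> that is maximal among those
  avoiding \<open>b\<close>.  For each variable \<open>x\<close> the chain \<open>(Q : x\<^sup>n)\<close> becomes stationary at some \<open>n\<close>.  Then
  \<open>b \<notin> Q + (x\<^sup>n)\<close>: from \<open>b = q + a x\<^sup>n\<close> and \<open>x b \<in> Q\<close> follows \<open>a x\<^sup>n\<^sup>+\<^sup>1 \<in> Q\<close>, hence \<open>a x\<^sup>n \<in> Q\<close> and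
  \<open>b \<in> Q\<close>.  By maximality \<open>x\<^sup>n \<in> Q\<close>, so \<open>Q\<close> contains a power of \<open>\<mm>\<close>, and therefore \<open>b\<close>.\<close>

lemma Krull_intersection:
  fixes K :: "'n::{finite,linorder} mpoly set"
  assumes K: "is_ideal K" and b: "\<And>s. \<exists>e\<in>max_ideal_power s. b - e \<in> K"
  obtains \<mu> where "\<mu> \<in> max_ideal" "(1 - \<mu>) * b \<in> K"
proof (rule ccontr)
  assume "\<not> thesis"
  then have no: "(1 - \<mu>) * b \<notin> K" if "\<mu> \<in> max_ideal" for \<mu>
    using \<open>\<And>\<mu>. \<mu> \<in> max_ideal \<Longrightarrow> (1 - \<mu>) * b \<in> K \<Longrightarrow> thesis\<close> that by blast
  define K' where "K' = {k + b * \<mu> | k \<mu>. k \<in> K \<and> \<mu> \<in> max_ideal}"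
  have K': "is_ideal K'"
    unfolding K'_def by (rule is_ideal_sum_image[OF K is_ideal_max_ideal])
  have "b \<notin> K'"
  proof
    assume "b \<in> K'"
    then obtain k \<mu> where "b = k + b * \<mu>" "k \<in> K" "\<mu> \<in> max_ideal"
      by (auto simp: K'_def)
    then have "(1 - \<mu>) * b \<in> K"
      by (metis add_diff_cancel_right' left_diff_distrib mult.commute mult_1)
    with no \<open>\<mu> \<in> max_ideal\<close> show False
      by blast
  qed
  obtain Q where "Q \<in> {Q. is_ideal Q \<and> K' \<subseteq> Q \<and> b \<notin> Q}"
    and Q_max: "\<And>J. J \<in> {Q. is_ideal Q \<and> K' \<subseteq> Q \<and> b \<notin> Q} \<Longrightarrow> Q \<subseteq> J \<Longrightarrow> J = Q"
    by (rule maximal_ideal_exists[OF noetherian_mpoly, of K' "{Q. is_ideal Q \<and> K' \<subseteq> Q \<and> b \<notin> Q}"])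
      (use K' \<open>b \<notin> K'\<close> in auto)
  then have Q: "is_ideal Q" "K' \<subseteq> Q" "b \<notin> Q"
    by auto
  have xb: "var i * b \<in> Q" for i
  proof -
    have "0 + b * var i \<in> K'"
      using ideal_0[OF K] var_in_max_ideal unfolding K'_def by blast
    then show ?thesis
      using Q(2) by (auto simp: mult.commute)
  qed
  have "\<exists>n. var i ^ n \<in> Q" for i
  proof -
    define C where "C n = {f. f * var i ^ n \<in> Q}" for n
    have "C 0 \<in> range C"
      by simp
    then obtain L where L: "L \<in> range C" "\<And>J. J \<in> range C \<Longrightarrow> L \<subseteq> J \<Longrightarrow> J = L"
      by (rule maximal_ideal_exists[OF noetherian_mpoly])
        (auto simp: C_def is_ideal_colon_elem[OF Q(1)])
    obtain n where n: "L = C n"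
      using L(1) by blast
    have "C n \<subseteq> C (Suc n)"
      using ideal_mult[OF Q(1)] by (auto simp: C_def mult.left_commute[of _ "var i"])
    then have stable: "C (Suc n) = C n"
      using L(2)[of "C (Suc n)"] by (simp add: n)
    define Q' where "Q' = {q + var i ^ n * a | q a. q \<in> Q \<and> a \<in> UNIV}"
    have "is_ideal Q'"
      unfolding Q'_def by (rule is_ideal_sum_image[OF Q(1)]) (simp add: is_ideal_iff)
    moreover have "Q \<subseteq> Q'"
    proof
      fix q assume "q \<in> Q"
      moreover have "q = q + var i ^ n * 0" by simp
      ultimately show "q \<in> Q'" unfolding Q'_def by blast
    qed
    moreover have "b \<notin> Q'"
    proof
      assume "b \<in> Q'"
      then obtain q a where qa: "b = q + var i ^ n * a" "q \<in> Q"
        by (auto simp: Q'_def)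
      have "var i * b - var i * q \<in> Q"
        by (rule ideal_diff[OF Q(1) xb ideal_mult[OF Q(1) qa(2)]])
      then have "a * var i ^ Suc n \<in> Q"
        by (simp add: qa(1) algebra_simps)
      then have "a \<in> C n"
        using stable by (auto simp: C_def)
      then have "var i ^ n * a \<in> Q"
        by (simp add: C_def mult.commute)
      then have "b \<in> Q"
        using ideal_add[OF Q(1) qa(2)] qa(1) by simp
      with Q(3) show False ..
    qed
    ultimately have "Q' = Q"
      using Q Q_max by auto
    moreover have "var i ^ n = 0 + var i ^ n * 1"
      by simp
    then have "var i ^ n \<in> Q'"
      unfolding Q'_def using ideal_0[OF Q(1)] by blast
    ultimately show ?thesis
      by blast
  qed
  then obtain n where n: "var i ^ n i \<in> Q" for i
    by metis
  define s where "s = (\<Sum>i\<in>UNIV. n i)"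
  have var_power: "var i ^ k = monomial (Poly_Mapping.single i k)" for i :: 'n and k
    by (induction k) (simp_all add: var_def mult_single single_add[symmetric])
  have "Poly_Mapping.single \<alpha> c \<in> Q" if "s \<le> total_deg \<alpha>" for \<alpha> c
  proof -
    have "\<exists>i. n i \<le> Poly_Mapping.lookup \<alpha> i"
    proof (rule ccontr)
      assume "\<not> ?thesis"
      then have "total_deg \<alpha> < s"
        unfolding total_deg_def s_def by (intro sum_strict_mono) (auto simp: not_le)
      with that show False
        by simp
    qed
    then obtain i where "n i \<le> Poly_Mapping.lookup \<alpha> i"
      by blast
    then have "\<alpha> = (\<alpha> - Poly_Mapping.single i (n i)) + Poly_Mapping.single i (n i)"
      by (intro monom_add_diff) (auto simp: lookup_single when_def)
    then have "Poly_Mapping.single \<alpha> c =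
        Poly_Mapping.single (\<alpha> - Poly_Mapping.single i (n i)) c * var i ^ n i"
      by (simp add: var_power mult_single)
    then show ?thesis
      using n[of i] ideal_mult[OF Q(1)] by simp
  qed
  then have "(\<Sum>\<alpha>\<in>Poly_Mapping.keys e. Poly_Mapping.single \<alpha> (Poly_Mapping.lookup e \<alpha>)) \<in> Q"
    if "e \<in> max_ideal_power s" for e
    using that by (intro ideal_sum[OF Q(1)]) (auto simp: max_ideal_power_def monomial_ideal_def)
  then have power_Q: "max_ideal_power s \<subseteq> Q"
    by (auto simp: sum_monomials[symmetric])
  obtain e where e: "e \<in> max_ideal_power s" "b - e \<in> K"
    using b by blast
  have "b - e = (b - e) + b * 0"
    by simp
  then have "b - e \<in> K'"
    using e(2) ideal_0[OF is_ideal_max_ideal] unfolding K'_def by blast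
  then have "b - e + e \<in> Q"
    using Q(2) power_Q e(1) by (blast intro: ideal_add[OF Q(1)])
  with Q(3) show False
    by simp
qed

section \<open>The functionals of the dual space\<close>

lemma lookup_pdiff:
  "Poly_Mapping.lookup (pdiff i p) \<beta> =
    of_nat (Poly_Mapping.lookup \<beta> i + 1) * Poly_Mapping.lookup p (\<beta> + Poly_Mapping.single i 1)"
proof -
  let ?t = "\<lambda>\<alpha>. of_nat (Poly_Mapping.lookup \<alpha> i) * Poly_Mapping.lookup p \<alpha>"
  let ?\<beta> = "\<beta> + Poly_Mapping.single i 1"
  have eq: "(?t \<alpha> when \<alpha> - Poly_Mapping.single i 1 = \<beta>) = (if \<alpha> = ?\<beta> then ?t \<alpha> else 0)" for \<alpha>
  proof (cases "Poly_Mapping.lookup \<alpha> i = 0")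
    case True
    then show ?thesis
      by (auto simp: lookup_add)
  next
    case False
    then have "\<alpha> = (\<alpha> - Poly_Mapping.single i 1) + Poly_Mapping.single i 1"
      by (intro monom_add_diff) (auto simp: lookup_single when_def)
    then have "\<alpha> - Poly_Mapping.single i 1 = \<beta> \<longleftrightarrow> \<alpha> = ?\<beta>"
      by (metis add_diff_cancel_right')
    then show ?thesis
      by (simp add: when_def)
  qed
  have "Poly_Mapping.lookup (pdiff i p) \<beta> =
      (\<Sum>\<alpha>\<in>Poly_Mapping.keys p. ?t \<alpha> when \<alpha> - Poly_Mapping.single i 1 = \<beta>)"
    by (simp add: pdiff_def lookup_sum lookup_single)
  also have "\<dots> = (if ?\<beta> \<in> Poly_Mapping.keys p then ?t ?\<beta> else 0)"
    unfolding eq by (simp only: sum.delta finite_keys)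
  also have "\<dots> = ?t ?\<beta>"
    by (simp add: in_keys_iff)
  finally show ?thesis
    by (simp add: lookup_add)
qed

lemma lookup_pdiff_power:
  "Poly_Mapping.lookup ((pdiff i ^^ k) p) \<beta> =
    fact (Poly_Mapping.lookup \<beta> i + k) / fact (Poly_Mapping.lookup \<beta> i) *
      Poly_Mapping.lookup p (\<beta> + Poly_Mapping.single i k)"
proof (induction k arbitrary: \<beta>)
  case (Suc k)
  have "\<beta> + Poly_Mapping.single i 1 + Poly_Mapping.single i k = \<beta> + Poly_Mapping.single i (Suc k)"
    by (simp add: add.assoc single_add[symmetric])
  then show ?case
    by (simp add: lookup_pdiff Suc lookup_add divide_simps del: of_nat_Suc)
qed simp

lemma lookup_fold_pdiff:
  assumes "distinct xs"
  shows "Poly_Mapping.lookup (fold (\<lambda>i. pdiff i ^^ Poly_Mapping.lookup \<alpha> i) xs p) \<beta> =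
    (\<Prod>i\<in>set xs. fact (Poly_Mapping.lookup \<beta> i + Poly_Mapping.lookup \<alpha> i) / fact (Poly_Mapping.lookup \<beta> i)) *
    Poly_Mapping.lookup p (\<beta> + (\<Sum>i\<in>set xs. Poly_Mapping.single i (Poly_Mapping.lookup \<alpha> i)))"
  using assms
proof (induction xs arbitrary: p)
  case (Cons x xs)
  have "Poly_Mapping.lookup (\<Sum>i\<in>set xs. Poly_Mapping.single i (Poly_Mapping.lookup \<alpha> i)) x = 0"
    using Cons.prems by (auto simp: lookup_sum lookup_single when_def)
  with Cons show ?case
    by (simp add: lookup_pdiff_power lookup_add add.assoc add.left_commute add.commute)
qed simp

lemma poly_eval_0: "poly_eval 0 p = Poly_Mapping.lookup p 0"
proof -
  have eq: "(\<Prod>i\<in>UNIV. (0 :: complex) ^ Poly_Mapping.lookup \<alpha> i) = (if \<alpha> = 0 then 1 else 0)"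
    for \<alpha> :: "'a monom"
  proof (cases "\<alpha> = 0")
    case False
    then obtain i where "Poly_Mapping.lookup \<alpha> i \<noteq> 0"
      by (metis poly_mapping_eqI lookup_zero)
    with False show ?thesis
      by (simp add: prod_zero_iff) blast
  qed simp
  show ?thesis
    by (simp add: poly_eval_def eq if_distrib in_keys_iff sum.delta cong: if_cong)
qed

text \<open>The factor \<open>1/\<alpha>!\<close> cancels the factorials produced by differentiating, so the functionals just read
  off coefficients.\<close>

lemma diff_functional_eq: "diff_functional \<alpha> g = Poly_Mapping.lookup g \<alpha>"
proof -
  have "(\<Sum>i\<in>UNIV. Poly_Mapping.single i (Poly_Mapping.lookup \<alpha> i)) = \<alpha>"
    by (rule poly_mapping_eqI) (simp add: lookup_sum lookup_single when_def)
  then show ?thesis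
    by (simp add: diff_functional_def pdiffs_def poly_eval_0 lookup_fold_pdiff)
qed

lemma diff_comb_eq:
  "diff_comb c g = (\<Sum>\<alpha>\<in>Poly_Mapping.keys c. Poly_Mapping.lookup c \<alpha> * Poly_Mapping.lookup g \<alpha>)"
  by (simp add: diff_comb_def diff_functional_eq)

lemma diff_comb_monomial: "diff_comb c (monomial \<alpha>) = Poly_Mapping.lookup c \<alpha>"
  by (simp add: diff_comb_eq lookup_single when_def if_distrib in_keys_iff sum.delta' cong: if_cong)

lemma diff_coeffs_diff_comb: "diff_coeffs (diff_comb c) = c"
  unfolding diff_coeffs_def
proof (rule the_equality)
  fix c'
  assume "diff_comb c = diff_comb c'"
  then show "c' = c"
    by (intro poly_mapping_eqI) (metis diff_comb_monomial)
qed simp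

definition linear_functional :: "('n mpoly \<Rightarrow> complex) \<Rightarrow> bool" where
  "linear_functional \<phi> \<longleftrightarrow>
    (\<forall>p q. \<phi> (p + q) = \<phi> p + \<phi> q) \<and> (\<forall>a p. \<phi> (Poly_Mapping.single 0 a * p) = a * \<phi> p)"

lemma linear_functional_add: "linear_functional \<phi> \<Longrightarrow> \<phi> (p + q) = \<phi> p + \<phi> q"
  and linear_functional_scale: "linear_functional \<phi> \<Longrightarrow> \<phi> (Poly_Mapping.single 0 a * p) = a * \<phi> p"
  by (auto simp: linear_functional_def)

lemma linear_functional_0: "linear_functional \<phi> \<Longrightarrow> \<phi> 0 = 0"
  using linear_functional_scale[of \<phi> 0 0] by simp

lemma linear_functional_sum: "linear_functional \<phi> \<Longrightarrow> \<phi> (sum f A) = (\<Sum>x\<in>A. \<phi> (f x))"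
  by (induction A rule: infinite_finite_induct) (auto simp: linear_functional_0 linear_functional_add)

lemma linear_functional_diff_comb: "linear_functional (diff_comb c)"
  by (simp add: linear_functional_def diff_comb_eq lookup_add lookup_scale distrib_left sum.distrib
      sum_distrib_left mult.left_commute)

lemma linear_functional_act: "linear_functional \<phi> \<Longrightarrow> linear_functional (act g \<phi>)"
  unfolding linear_functional_def act_def by (simp add: distrib_left mult.left_commute[of g])

text \<open>The functionals in \<open>D\<^sub>0\<close> are the linear ones that are continuous for the topology given by the
  powers of the maximal ideal.\<close>

lemma continuous_functional_eq_diff_comb:
  fixes \<phi> :: "'n::{finite,linorder} mpoly \<Rightarrow> complex"
  assumes \<phi>: "linear_functional \<phi>" and zero: "\<And>p. p \<in> max_ideal_power s \<Longrightarrow> \<phi> p = 0"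
  obtains c where "\<phi> = diff_comb c" "\<And>\<alpha>. Poly_Mapping.lookup c \<alpha> = \<phi> (monomial \<alpha>)"
    "\<And>\<alpha>. \<alpha> \<in> Poly_Mapping.keys c \<Longrightarrow> total_deg \<alpha> < s"
proof
  define c where "c = Abs_poly_mapping (\<lambda>\<alpha>. \<phi> (monomial \<alpha>))"
  have small: "\<phi> (monomial \<alpha>) = 0" if "s \<le> total_deg \<alpha>" for \<alpha>
    using that by (intro zero) (simp add: max_ideal_power_def monomial_ideal_def)
  then have "{\<alpha>. \<phi> (monomial \<alpha>) \<noteq> 0} \<subseteq> {\<alpha>. total_deg \<alpha> \<le> s}"
    using small nat_le_linear by blast
  then have "finite {\<alpha>. \<phi> (monomial \<alpha>) \<noteq> 0}"
    using finite_total_deg_le finite_subset by blast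
  then show c: "Poly_Mapping.lookup c \<alpha> = \<phi> (monomial \<alpha>)" for \<alpha>
    by (simp add: c_def)
  show "total_deg \<alpha> < s" if "\<alpha> \<in> Poly_Mapping.keys c" for \<alpha>
    using that small[of \<alpha>] by (auto simp: in_keys_iff c not_le[symmetric])
  show "\<phi> = diff_comb c"
  proof
    fix p :: "'n mpoly"
    let ?S = "Poly_Mapping.keys p \<union> Poly_Mapping.keys c"
    have "\<phi> p = \<phi> (\<Sum>\<alpha>\<in>Poly_Mapping.keys p. Poly_Mapping.single 0 (Poly_Mapping.lookup p \<alpha>) * monomial \<alpha>)"
      by (simp add: mult_single sum_monomials[symmetric])
    also have "\<dots> = (\<Sum>\<alpha>\<in>Poly_Mapping.keys p. Poly_Mapping.lookup c \<alpha> * Poly_Mapping.lookup p \<alpha>)"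
      by (simp only: linear_functional_sum[OF \<phi>] linear_functional_scale[OF \<phi>] c)
        (simp only: mult.commute)
    also have "\<dots> = (\<Sum>\<alpha>\<in>?S. Poly_Mapping.lookup c \<alpha> * Poly_Mapping.lookup p \<alpha>)"
      by (rule sum.mono_neutral_left) (auto simp: in_keys_iff)
    also have "\<dots> = diff_comb c p"
      unfolding diff_comb_eq by (rule sum.mono_neutral_right) (auto simp: in_keys_iff)
    finally show "\<phi> p = diff_comb c p" .
  qed
qed

lemma separating_functional:
  fixes U :: "'n::finite mpoly set"
  assumes U: "is_ideal U" and "v \<notin> U"
  obtains \<phi> where "linear_functional \<phi>" "\<And>u. u \<in> U \<Longrightarrow> \<phi> u = 0" "\<phi> v = 1"
proof -
  let ?scale = "\<lambda>a p. Poly_Mapping.single 0 a * p :: 'n mpoly"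
  interpret vs: vector_space ?scale
    by unfold_locales
      (simp_all add: distrib_left distrib_right single_add mult.assoc[symmetric] mult_single)
  interpret c: vector_space "(*) :: complex \<Rightarrow> complex \<Rightarrow> complex"
    by unfold_locales (simp_all add: algebra_simps)
  interpret vp: vector_space_pair ?scale "(*) :: complex \<Rightarrow> complex \<Rightarrow> complex" ..
  have sub: "vs.subspace U"
    using U by (simp add: vs.subspace_def is_ideal_iff)
  obtain B where B: "B \<subseteq> U" "vs.independent B" "U \<subseteq> vs.span B"
    using vs.maximal_independent_subset[of U] by blast
  have "v \<notin> vs.span B"
    using vs.span_minimal[OF B(1) sub] assms(2) by blast
  then have "vs.independent (insert v B)"
    by (rule vs.independent_insertI[OF _ B(2)])
  then obtain \<phi> where \<phi>: "Vector_Spaces.linear ?scale (*) \<phi>"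
      "\<And>x. x \<in> insert v B \<Longrightarrow> \<phi> x = (if x = v then 1 else 0)"
    using vp.linear_independent_extend[of "insert v B" "\<lambda>x. if x = v then 1 else 0"] by blast
  interpret lin: Vector_Spaces.linear ?scale "(*)" \<phi>
    by (rule \<phi>(1))
  show ?thesis
  proof
    show "linear_functional \<phi>"
      by (simp add: linear_functional_def lin.add lin.scale)
    show "\<phi> v = 1"
      using \<phi>(2) by simp
    show "\<phi> u = 0" if "u \<in> U" for u
    proof (rule lin.eq_0_on_span)
      show "u \<in> vs.span B"
        using B(3) that by blast
      show "\<phi> x = 0" if "x \<in> B" for x
        using \<phi>(2)[of x] that B(1) assms(2) by auto
    qed
  qed
qed

section \<open>Initial terms of the dual space\<close>

text \<open>In a local order, multiplication by a monomial never makes a monomial larger.\<close>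

lemma strictly_below_closed:
  assumes r: "local_monomial_order r" and "\<beta> \<in> strictly_below r \<alpha>"
  shows "\<gamma> + \<beta> \<in> strictly_below r \<alpha>"
proof -
  have lin: "linear_order r"
    using r by (simp add: local_monomial_order_def)
  have "(\<gamma> + \<beta>, 0 + \<beta>) \<in> r"
    using r unfolding local_monomial_order_def by blast
  then have le: "(\<gamma> + \<beta>, \<beta>) \<in> r"
    by simp
  moreover have \<beta>: "(\<beta>, \<alpha>) \<in> r" "\<beta> \<noteq> \<alpha>"
    using assms(2) by (simp_all add: strictly_below_def)
  ultimately have "(\<gamma> + \<beta>, \<alpha>) \<in> r"
    using linear_orderD(2)[OF lin] by blast
  moreover have "\<gamma> + \<beta> \<noteq> \<alpha>"
    using linear_orderD(3)[OF lin \<beta>(1)] le \<beta>(2) by metis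
  ultimately show ?thesis
    by (simp add: strictly_below_def)
qed

text \<open>Let \<open>N\<close> be the ideal spanned by the monomials below \<open>x\<^sup>\<alpha>\<close>.  A functional \<open>\<phi>\<close> in the dual space
  for which \<open>l \<cdot> \<phi>\<close> has initial term \<open>\<partial>\<^sup>\<alpha>\<close> is one that vanishes on \<open>U = I + l N + \<mm>\<^sup>s\<close>, for some \<open>s\<close>,
  but not at \<open>l x\<^sup>\<alpha>\<close>.  If there were none for any \<open>s\<close>, Krull's theorem for \<open>I + l N\<close> would give
  \<open>(1 - \<mu>) l x\<^sup>\<alpha> \<in> I + l N\<close> with \<open>\<mu> \<in> \<mm>\<close>.  As \<open>l\<close> can be cancelled and \<open>\<mu> x\<^sup>\<alpha> \<in> N\<close>, this would put
  \<open>x\<^sup>\<alpha>\<close> into \<open>I + N\<close>, that is, make it an initial monomial of \<open>I\<close>.\<close>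

lemma dual_initial_exists:
  fixes I :: "'n::{finite,linorder} mpoly set"
  assumes r: "local_monomial_order r" and I: "is_ideal I"
    and nzd: "\<And>g. l * g \<in> I \<Longrightarrow> g \<in> I" and "\<alpha> \<notin> initials r I"
  obtains k where "\<And>d. k \<le> d \<Longrightarrow> \<alpha> \<in> dual_initials r (act l ` dual_space_le (d + 1) I)"
proof -
  have lin: "linear_order r"
    using r by (simp add: local_monomial_order_def)
  define N where "N = monomial_ideal (strictly_below r \<alpha>)"
  have N: "is_ideal N"
    unfolding N_def by (rule is_ideal_monomial_ideal) (rule strictly_below_closed[OF r])
  define K where "K = {i + l * n | i n. i \<in> I \<and> n \<in> N}"
  have K: "is_ideal K"
    unfolding K_def by (rule is_ideal_sum_image[OF I N])
  have "\<not> (\<forall>s. \<exists>e\<in>max_ideal_power s. l * monomial \<alpha> - e \<in> K)"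
  proof
    assume "\<forall>s. \<exists>e\<in>max_ideal_power s. l * monomial \<alpha> - e \<in> K"
    then obtain \<mu> where \<mu>: "\<mu> \<in> max_ideal" "(1 - \<mu>) * (l * monomial \<alpha>) \<in> K"
      using Krull_intersection[OF K] by blast
    then obtain i n where n: "(1 - \<mu>) * (l * monomial \<alpha>) = i + l * n" "i \<in> I" "n \<in> N"
      by (auto simp: K_def)
    define t where "t = monomial \<alpha> * \<mu> + n"
    have "l * (monomial \<alpha> - t) = i"
      using n(1) by (simp add: t_def algebra_simps)
    then have lead_I: "monomial \<alpha> - t \<in> I"
      using n(2) nzd[of "monomial \<alpha> - t"] by simp
    have "monomial \<alpha> * \<mu> \<in> N"
      unfolding N_def monomial_ideal_def
    proof clarify
      fix \<beta>
      assume "\<beta> \<in> Poly_Mapping.keys (monomial \<alpha> * \<mu>)"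
      then obtain \<gamma> where \<gamma>: "\<gamma> \<in> Poly_Mapping.keys \<mu>" "\<beta> = \<gamma> + \<alpha>"
        by (auto simp: keys_single_mult add.commute)
      then have "\<gamma> \<noteq> 0"
        using \<mu>(1) by (auto simp: max_ideal_iff in_keys_iff)
      moreover have "(\<gamma> + \<alpha>, 0 + \<alpha>) \<in> r"
        using r unfolding local_monomial_order_def by blast
      ultimately show "\<beta> \<in> strictly_below r \<alpha>"
        by (simp add: strictly_below_def \<gamma>(2))
    qed
    then have t: "Poly_Mapping.keys t \<subseteq> strictly_below r \<alpha>"
      using ideal_add[OF N _ n(3)] by (simp add: t_def N_def monomial_ideal_def)
    moreover from this have "Poly_Mapping.lookup t \<alpha> = 0"
      by (auto simp: strictly_below_def in_keys_iff)
    ultimately have "is_lead r (monomial \<alpha> - t) \<alpha>"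
      using linear_orderD(1)[OF lin]
      by (auto simp: is_lead_def in_keys_iff lookup_minus lookup_single strictly_below_def when_def
          split: if_splits)
    with lead_I show False
      using assms(4) by (auto simp: initials_iff[OF lin])
  qed
  then obtain s where s: "\<And>e. e \<in> max_ideal_power s \<Longrightarrow> l * monomial \<alpha> - e \<notin> K"
    by blast
  \<comment> \<open>The factor 1 only fits the form of \<open>is_ideal_sum_image\<close>.\<close>
  define U where "U = {k + 1 * e | k e. k \<in> K \<and> e \<in> max_ideal_power s}"
  have U: "is_ideal U"
    unfolding U_def by (rule is_ideal_sum_image[OF K is_ideal_max_ideal_power])
  have in_U: "k + e \<in> U" if "k \<in> K" "e \<in> max_ideal_power s" for k e
    unfolding U_def using that by force
  have "l * monomial \<alpha> \<notin> U"
  proof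
    assume "l * monomial \<alpha> \<in> U"
    then obtain k e where "l * monomial \<alpha> = k + 1 * e" "k \<in> K" "e \<in> max_ideal_power s"
      by (auto simp: U_def)
    with s[of e] show False
      by simp
  qed
  then obtain \<phi> where \<phi>: "linear_functional \<phi>" "\<And>u. u \<in> U \<Longrightarrow> \<phi> u = 0" "\<phi> (l * monomial \<alpha>) = 1"
    using separating_functional[OF U] by blast
  have \<phi>_s: "\<phi> e = 0" if "e \<in> max_ideal_power s" for e
    using \<phi>(2)[OF in_U[OF ideal_0[OF K] that]] by simp
  have \<phi>_K: "\<phi> k = 0" if "k \<in> K" for k
    using \<phi>(2)[OF in_U[OF that ideal_0[OF is_ideal_max_ideal_power]]] by simp
  have \<phi>_I: "\<phi> i = 0" if "i \<in> I" for i
  proof -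
    have "i + l * 0 \<in> K"
      unfolding K_def using that ideal_0[OF N] by blast
    then show ?thesis
      using \<phi>_K by simp
  qed
  have \<phi>_N: "\<phi> (l * n) = 0" if "n \<in> N" for n
  proof -
    have "0 + l * n \<in> K"
      unfolding K_def using that ideal_0[OF I] by blast
    then show ?thesis
      using \<phi>_K by simp
  qed
  obtain c where c: "\<phi> = diff_comb c" "\<And>\<alpha>. \<alpha> \<in> Poly_Mapping.keys c \<Longrightarrow> total_deg \<alpha> < s"
    by (rule continuous_functional_eq_diff_comb[where s = s]) (rule \<phi>(1), erule \<phi>_s, rule that)
  have "linear_functional (act l \<phi>)"
    by (rule linear_functional_act[OF \<phi>(1)])
  moreover have "act l \<phi> e = 0" if "e \<in> max_ideal_power s" for e
    unfolding act_def by (rule \<phi>_s) (rule ideal_mult[OF is_ideal_max_ideal_power that])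
  ultimately obtain c' where c': "act l \<phi> = diff_comb c'"
      "\<And>\<beta>. Poly_Mapping.lookup c' \<beta> = act l \<phi> (monomial \<beta>)"
    by (rule continuous_functional_eq_diff_comb[where s = s]) (assumption, rule that)
  have "is_lead (r\<inverse>) c' \<alpha>"
    unfolding is_lead_def
  proof (intro conjI ballI)
    show "\<alpha> \<in> Poly_Mapping.keys c'"
      by (simp add: in_keys_iff c'(2) act_def \<phi>(3))
    fix \<beta>
    assume "\<beta> \<in> Poly_Mapping.keys c'"
    then have "monomial \<beta> \<notin> N"
      using \<phi>_N by (auto simp: in_keys_iff c'(2) act_def)
    then have "\<beta> \<notin> strictly_below r \<alpha>"
      by (simp add: N_def monomial_ideal_def)
    then show "(\<beta>, \<alpha>) \<in> r\<inverse>"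
      using linear_orderD(1,4)[OF lin] by (auto simp: strictly_below_def)
  qed
  moreover have "c' \<noteq> 0"
    using calculation by (auto simp: is_lead_def)
  ultimately have lead: "lead_exp (r\<inverse>) (diff_coeffs (act l \<phi>)) = \<alpha>"
    using is_lead_iff[of "r\<inverse>" c' \<alpha>] lin by (simp add: c'(1) diff_coeffs_diff_comb)
  have "act l \<phi> \<noteq> (\<lambda>_. 0)"
    using \<phi>(3) by (auto simp: act_def dest: fun_cong[of _ _ "monomial \<alpha>"])
  moreover have "\<phi> \<in> dual_space_le (d + 1) I" if "s \<le> d" for d
    using that c(2) \<phi>_I unfolding dual_space_le_def dual_space_def D0_def D0_le_def c(1) by force
  ultimately have "\<alpha> \<in> dual_initials r (act l ` dual_space_le (d + 1) I)" if "s \<le> d" for d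
    unfolding dual_initials_def using lead that by blast
  with that show ?thesis
    by blast
qed

text \<open>The supports of \<open>f\<close> and of a functional with initial term \<open>\<partial>\<^sup>\<beta>\<close> meet in \<open>\<beta>\<close> only, so such a
  functional does not vanish at \<open>f\<close>; but \<open>(l \<cdot> q)(f) = q(l f) = 0\<close>.\<close>

lemma not_dual_initial:
  fixes I :: "'n::{finite,linorder} mpoly set"
  assumes lin: "linear_order r" and f: "is_lead r f \<beta>" and "l * f \<in> I"
  shows "\<beta> \<notin> dual_initials r (act l ` dual_space_le k I)"
proof
  assume "\<beta> \<in> dual_initials r (act l ` dual_space_le k I)"
  then obtain q where q: "q \<in> dual_space I" "act l q \<noteq> (\<lambda>_. 0)"
      "\<beta> = lead_exp (r\<inverse>) (diff_coeffs (act l q))"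
    by (auto simp: dual_initials_def dual_space_le_def)
  obtain c where c: "q = diff_comb c"
    using q(1) by (auto simp: dual_space_def D0_def)
  define s where "s = Suc (\<Sum>\<alpha>\<in>Poly_Mapping.keys c. total_deg \<alpha>)"
  have deg: "total_deg \<alpha> < s" if "\<alpha> \<in> Poly_Mapping.keys c" for \<alpha>
    unfolding s_def less_Suc_eq_le using that by (intro member_le_sum) auto
  have q_0: "q e = 0" if "e \<in> max_ideal_power s" for e
  proof -
    have "Poly_Mapping.lookup e \<alpha> = 0" if "\<alpha> \<in> Poly_Mapping.keys c" for \<alpha>
      using \<open>e \<in> max_ideal_power s\<close> deg[OF that]
      by (force simp: max_ideal_power_def monomial_ideal_def in_keys_iff)
    then show ?thesis
      by (simp add: c diff_comb_eq)
  qed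
  have "linear_functional (act l q)"
    unfolding c by (rule linear_functional_act[OF linear_functional_diff_comb])
  moreover have "act l q e = 0" if "e \<in> max_ideal_power s" for e
    unfolding act_def by (rule q_0) (rule ideal_mult[OF is_ideal_max_ideal_power that])
  ultimately obtain c' where c': "act l q = diff_comb c'"
    by (rule continuous_functional_eq_diff_comb[where s = s]) (assumption, rule that)
  have "c' \<noteq> 0"
    using q(2) by (auto simp: c' diff_comb_eq)
  then have lead: "is_lead (r\<inverse>) c' \<beta>"
    using is_lead_iff[of "r\<inverse>" c' \<beta>] lin q(3) by (simp add: c' diff_coeffs_diff_comb)
  have "Poly_Mapping.lookup f \<gamma> = 0" if "\<gamma> \<in> Poly_Mapping.keys c' - {\<beta>}" for \<gamma>
    using that lead f linear_orderD(3)[OF lin] unfolding is_lead_def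
    by (metis DiffE converse_iff in_keys_iff insertI1)
  then have "act l q f = Poly_Mapping.lookup c' \<beta> * Poly_Mapping.lookup f \<beta>"
    unfolding c' diff_comb_eq using lead
    by (subst sum.remove[of _ \<beta>]) (auto simp: is_lead_def)
  also have "\<dots> \<noteq> 0"
    using lead f by (auto simp: is_lead_def in_keys_iff)
  finally show False
    using q(1) assms(3) by (simp add: act_def dual_space_def)
qed

section \<open>Initial monomials of socle elements\<close>

lemma polys_le_mono: "d \<le> e \<Longrightarrow> polys_le d \<subseteq> polys_le e"
  by (auto simp: polys_le_def)

lemma polys_le_exists: "\<exists>d. f \<in> polys_le d"
proof
  show "f \<in> polys_le (\<Sum>\<alpha>\<in>Poly_Mapping.keys f. total_deg \<alpha>)"
    unfolding polys_le_def by (auto intro!: member_le_sum)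
qed

lemma polys_le_exists_finite:
  assumes "finite S"
  shows "\<exists>d. S \<subseteq> polys_le d"
  using assms
proof (induction S)
  case (insert f S)
  then obtain d e where "S \<subseteq> polys_le d" "f \<in> polys_le e"
    using polys_le_exists by blast
  then have "insert f S \<subseteq> polys_le (max d e)"
    using polys_le_mono[of d "max d e"] polys_le_mono[of e "max d e"] by auto
  then show ?case ..
qed simp

text \<open>Ordinary division of \<open>g\<close> by \<open>I\<close> need not terminate, since a local order is no well-order.  As in
  Mora's normal form algorithm, elements \<open>f\<^sub>0\<close> of the class \<open>A = g + I\<close> itself are therefore admitted as
  divisors: a proper monomial multiple of \<open>f\<^sub>0\<close> is in \<open>I\<close>, because \<open>\<mm> g \<subseteq> I\<close>.  Dickson's lemma, applied
  to the initial exponents together with the excess of the degree over the initial degree, provides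
  finitely many \<open>f\<^sub>0\<close> such that the initial monomial of every \<open>f \<in> A\<close> is a multiple of the one of some
  \<open>f\<^sub>0\<close>, and the corresponding multiple of \<open>f\<^sub>0\<close> does not exceed the degree of \<open>f\<close>.  If all initial
  monomials of \<open>A\<close> were in \<open>in(I)\<close>, every element of \<open>A\<close> of degree at most a fixed \<open>d\<close> could be reduced
  without leaving this degree, which is impossible for the one with the least initial monomial.\<close>

lemma exists_initial_outside:
  fixes I :: "'n::{finite,linorder} mpoly set"
  assumes r: "monomial_order r" and I: "is_ideal I"
    and "g \<notin> I" and socle: "\<And>x. x \<in> max_ideal \<Longrightarrow> x * g \<in> I"
  obtains f \<beta> where "\<And>x. x \<in> max_ideal \<Longrightarrow> x * f \<in> I" "is_lead r f \<beta>" "\<beta> \<notin> initials r I"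
proof (rule ccontr)
  assume "\<not> thesis"
  note neg = this and result = that
  have lin: "linear_order r"
    by (rule monomial_order_linear[OF r])
  define A where "A = {f. f - g \<in> I}"
  have socle_A: "x * f \<in> I" if "f \<in> A" "x \<in> max_ideal" for f x
  proof -
    have "x * (f - g) + x * g \<in> I"
      using that socle by (auto simp: A_def intro: ideal_add[OF I] ideal_mult[OF I])
    then show ?thesis
      by (simp add: algebra_simps)
  qed
  define lead where "lead f = lead_exp r f" for f
  have lead: "is_lead r f (lead f)" if "f \<in> A" for f
  proof -
    have "f \<noteq> 0"
      using that assms(3) module.subspace_neg[OF module_mult I, of "- g"] by (auto simp: A_def)
    then show ?thesis
      by (simp add: lead_def is_lead_iff[OF lin])
  qed
  have "\<exists>h. h \<in> I \<and> is_lead r h (lead f)" if "f \<in> A" for f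
  proof -
    have "lead f \<in> initials r I"
      using neg result[OF socle_A[OF that] lead[OF that]] by blast
    then show ?thesis
      by (auto simp: initials_iff[OF lin])
  qed
  then obtain h where h: "\<And>f. f \<in> A \<Longrightarrow> h f \<in> I" "\<And>f. f \<in> A \<Longrightarrow> is_lead r (h f) (lead f)"
    by metis
  define deg where "deg f = Max (total_deg ` Poly_Mapping.keys f)" for f :: "'n mpoly"
  have deg: "total_deg \<alpha> \<le> deg f" if "\<alpha> \<in> Poly_Mapping.keys f" for \<alpha> f
    unfolding deg_def using that by (intro Max_ge) auto
  have deg_le: "deg f \<le> d" if "f \<in> A" "f \<in> polys_le d" for f d
    unfolding deg_def using that lead[OF that(1)] by (subst Max_le_iff) (auto simp: polys_le_def is_lead_def)
  \<comment> \<open>The truncated difference is exact, because \<open>lead f\<close> occurs in \<open>f\<close>.\<close>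
  define e where "e f k =
    (case k of None \<Rightarrow> deg f - total_deg (lead f) | Some i \<Rightarrow> Poly_Mapping.lookup (lead f) i)" for f k
  obtain A0 where A0: "finite A0" "A0 \<subseteq> A" "\<And>f. f \<in> A \<Longrightarrow> \<exists>f0\<in>A0. \<forall>k. e f0 k \<le> e f k"
    using Dickson_finite_basis[of A e] by blast
  obtain d where d: "insert g (h ` A0) \<subseteq> polys_le d"
    using polys_le_exists_finite[of "insert g (h ` A0)"] A0(1) by blast
  define S where "S = lead ` (A \<inter> polys_le d)"
  have "S \<subseteq> {\<alpha>. total_deg \<alpha> \<le> d}"
    using lead by (auto simp: S_def polys_le_def is_lead_def)
  then have "finite S"
    using finite_total_deg_le finite_subset by blast
  moreover have "g \<in> A \<inter> polys_le d"
    using d ideal_0[OF I] by (simp add: A_def)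
  then have "S \<noteq> {}"
    by (auto simp: S_def)
  ultimately obtain \<alpha> where \<alpha>: "\<alpha> \<in> S" "\<And>\<beta>. \<beta> \<in> S \<Longrightarrow> (\<alpha>, \<beta>) \<in> r"
    using finite_greatest[of "r\<inverse>" S] lin by auto
  then obtain f where f: "f \<in> A" "f \<in> polys_le d" "lead f = \<alpha>"
    by (auto simp: S_def)
  obtain f0 where f0: "f0 \<in> A0" "\<And>k. e f0 k \<le> e f k"
    using A0(3)[OF f(1)] by blast
  have "f0 \<in> A"
    using f0(1) A0(2) by blast
  define \<gamma> where "\<gamma> = \<alpha> - lead f0"
  have \<gamma>: "\<alpha> = \<gamma> + lead f0"
    unfolding \<gamma>_def
  proof (rule monom_add_diff)
    show "Poly_Mapping.lookup (lead f0) i \<le> Poly_Mapping.lookup \<alpha> i" for i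
      using f0(2)[of "Some i"] by (simp add: e_def f(3))
  qed
  have "\<exists>q\<in>I \<inter> polys_le d. is_lead r q \<alpha>"
  proof (cases "\<gamma> = 0")
    case True
    then show ?thesis
      using h[OF \<open>f0 \<in> A\<close>] d f0(1) \<gamma> by auto
  next
    case False
    have lead0: "lead f0 \<in> Poly_Mapping.keys f0" "lead f \<in> Poly_Mapping.keys f"
      using lead[OF \<open>f0 \<in> A\<close>] lead[OF f(1)] by (simp_all add: is_lead_def)
    have "deg f0 - total_deg (lead f0) \<le> deg f - total_deg (lead f)"
      using f0(2)[of None] by (simp add: e_def)
    moreover have "total_deg (lead f) = total_deg \<gamma> + total_deg (lead f0)"
      by (simp add: f(3) \<gamma> total_deg_add)
    ultimately have "total_deg \<gamma> + deg f0 \<le> d"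
      using deg[OF lead0(1)] deg[OF lead0(2)] deg_le[OF f(1,2)] by linarith
    then have "total_deg (\<gamma> + \<beta>) \<le> d" if "\<beta> \<in> Poly_Mapping.keys f0" for \<beta>
      using deg[OF that] by (simp add: total_deg_add)
    then have "monomial \<gamma> * f0 \<in> polys_le d"
      by (auto simp: polys_le_def keys_single_mult)
    moreover have "monomial \<gamma> * f0 \<in> I"
      using False by (intro socle_A \<open>f0 \<in> A\<close>) (simp add: max_ideal_iff lookup_single)
    ultimately show ?thesis
      using is_lead_monomial_mult[OF r lead[OF \<open>f0 \<in> A\<close>], of \<gamma>] \<gamma> by auto
  qed
  then obtain q where q: "q \<in> I" "q \<in> polys_le d" "is_lead r q \<alpha>"
    by blast
  obtain c where c: "Poly_Mapping.keys (f - Poly_Mapping.single 0 c * q) \<subseteq> strictly_below r \<alpha>"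
    using cancel_lead[of r f \<alpha> q] lead[OF f(1)] f(3) q(3) by blast
  define f' where "f' = f - Poly_Mapping.single 0 c * q"
  have "f' - g \<in> I"
  proof -
    have "(f - g) - Poly_Mapping.single 0 c * q \<in> I"
      using f(1) by (intro ideal_diff[OF I _ ideal_mult[OF I q(1)]]) (simp add: A_def)
    then show ?thesis
      by (simp add: f'_def algebra_simps)
  qed
  then have "f' \<in> A"
    by (simp add: A_def)
  moreover have "f' \<in> polys_le d"
  proof -
    have "\<beta> \<in> Poly_Mapping.keys f \<union> Poly_Mapping.keys q" if "\<beta> \<in> Poly_Mapping.keys f'" for \<beta>
      using that by (auto simp: f'_def in_keys_iff lookup_minus lookup_scale)
    then show ?thesis
      using f(2) q(2) by (auto simp: polys_le_def)
  qed
  ultimately have "(\<alpha>, lead f') \<in> r" "lead f' \<in> strictly_below r \<alpha>"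
    using \<alpha>(2)[of "lead f'"] c lead[of f'] by (auto simp: S_def f'_def[symmetric] is_lead_def)
  then show False
    using linear_orderD(3)[OF lin] by (auto simp: strictly_below_def)
qed

section \<open>Saturation, associated primes and generic linear forms\<close>

lemma is_prime_max_ideal: "is_prime_ideal (max_ideal :: 'n::finite mpoly set)"
proof -
  have "a \<in> max_ideal \<or> b \<in> max_ideal" if ab: "a * b \<in> max_ideal" for a b :: "'n mpoly"
  proof (rule disjCI)
    assume "b \<notin> max_ideal"
    define c where "c = Poly_Mapping.lookup a 0"
    have "a - Poly_Mapping.single 0 c \<in> max_ideal"
      by (simp add: max_ideal_iff lookup_minus c_def)
    then have "a * b - (a - Poly_Mapping.single 0 c) * b \<in> max_ideal"
      using ideal_diff[OF is_ideal_max_ideal ab] ideal_mult_right[OF is_ideal_max_ideal] by blast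
    then have "Poly_Mapping.single 0 c * b \<in> max_ideal"
      by (simp add: algebra_simps)
    then show "a \<in> max_ideal"
      using \<open>b \<notin> max_ideal\<close> by (simp add: max_ideal_iff lookup_scale c_def)
  qed
  moreover have "1 \<notin> (max_ideal :: 'n mpoly set)"
    by (simp add: max_ideal_iff)
  ultimately show ?thesis
    using is_ideal_max_ideal by (auto simp: is_prime_ideal_def)
qed

lemma socle_element_imp_Ass:
  assumes I: "is_ideal I" and "g \<notin> I" and "\<And>x. x \<in> max_ideal \<Longrightarrow> x * g \<in> I"
  shows "(max_ideal :: 'n::finite mpoly set) \<in> Ass I"
proof -
  have "1 \<notin> {f. f * g \<in> I}"
    using assms(2) by simp
  then have "{f. f * g \<in> I} \<noteq> UNIV"
    by blast
  then have "{f. f * g \<in> I} = max_ideal"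
    by (rule max_ideal_maximal[OF is_ideal_colon_elem[OF I]]) (use assms(3) in blast)
  then show ?thesis
    using is_prime_max_ideal unfolding Ass_def by blast
qed

text \<open>An element of \<open>(I : \<mm>\<^sup>k\<^sup>+\<^sup>1)\<close> outside \<open>(I : \<mm>\<^sup>k)\<close> has a multiple outside \<open>I\<close> that is annihilated by
  \<open>\<mm>\<close> modulo \<open>I\<close>.\<close>

lemma saturation_eq_if_not_Ass:
  fixes I :: "'n::finite mpoly set"
  assumes I: "is_ideal I" and "max_ideal \<notin> Ass I"
  shows "saturation I max_ideal \<subseteq> I"
proof -
  have "g \<in> I" if "g \<in> colon I (ideal_power max_ideal k)" for g k
    using that
  proof (induction k arbitrary: g)
    case 0
    then have "g * b \<in> I" for b
      by (simp add: colon_def)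
    from this[of 1] show ?case
      by simp
  next
    case (Suc k)
    have "g * b \<in> I" if b: "b \<in> ideal_power max_ideal k" for b
    proof (rule ccontr)
      assume "g * b \<notin> I"
      moreover have "x * (g * b) \<in> I" if "x \<in> max_ideal" for x
      proof -
        have "x * b \<in> ideal_power max_ideal (Suc k)"
          using that b by (auto intro: ideal_gen_base)
        then have "g * (x * b) \<in> I"
          using Suc.prems by (auto simp: colon_def simp del: ideal_power.simps)
        then show ?thesis
          by (simp add: mult.left_commute)
      qed
      ultimately show False
        using socle_element_imp_Ass[OF I] assms(2) by blast
    qed
    then show ?case
      by (intro Suc.IH[of g]) (auto simp: colon_def)
  qed
  then show ?thesis
    by (auto simp: saturation_def)
qed

lemma poly_eval_single:
  "poly_eval c (Poly_Mapping.single \<alpha> a) = a * (\<Prod>i\<in>UNIV. (c $ i) ^ Poly_Mapping.lookup \<alpha> i)"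
  by (simp add: poly_eval_def)

lemma poly_eval_add: "poly_eval c (p + q) = poly_eval c p + poly_eval c q"
  unfolding poly_eval_def by (rule setsum_keys_plus_distrib) (simp_all add: distrib_right)

lemma poly_eval_sum: "poly_eval c (sum f A) = (\<Sum>x\<in>A. poly_eval c (f x))"
  by (induction A rule: infinite_finite_induct) (simp_all add: poly_eval_add, simp_all add: poly_eval_def)

lemma poly_eval_mult: "poly_eval c (p * q) = poly_eval c p * poly_eval c q"
proof -
  let ?m = "\<lambda>\<alpha>. \<Prod>i\<in>UNIV. (c $ i) ^ Poly_Mapping.lookup \<alpha> i"
  have "p * q = (\<Sum>\<alpha>\<in>Poly_Mapping.keys p. Poly_Mapping.single \<alpha> (Poly_Mapping.lookup p \<alpha>)) *
      (\<Sum>\<beta>\<in>Poly_Mapping.keys q. Poly_Mapping.single \<beta> (Poly_Mapping.lookup q \<beta>))"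
    by (simp add: sum_monomials[symmetric])
  also have "poly_eval c \<dots> = (\<Sum>\<alpha>\<in>Poly_Mapping.keys p. \<Sum>\<beta>\<in>Poly_Mapping.keys q.
      Poly_Mapping.lookup p \<alpha> * Poly_Mapping.lookup q \<beta> * ?m (\<alpha> + \<beta>))"
    by (simp add: sum_product mult_single poly_eval_sum poly_eval_single)
  also have "\<dots> = poly_eval c p * poly_eval c q"
    by (simp add: poly_eval_def sum_product lookup_add power_add prod.distrib ac_simps)
  finally show ?thesis .
qed

lemma poly_eval_prod: "poly_eval c (prod f A) = (\<Prod>x\<in>A. poly_eval c (f x))"
  by (induction A rule: infinite_finite_induct)
    (simp_all add: poly_eval_mult, simp_all add: poly_eval_def)

lemma poly_eval_linear_form: "poly_eval c (linear_form a) = (\<Sum>i\<in>UNIV. a $ i * c $ i)"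
proof -
  have "(\<Prod>j\<in>UNIV. (c $ j) ^ Poly_Mapping.lookup (Poly_Mapping.single i (1::nat)) j) = c $ i" for i
  proof -
    have "(\<Prod>j\<in>UNIV. (c $ j) ^ Poly_Mapping.lookup (Poly_Mapping.single i (1::nat)) j) =
        (\<Prod>j\<in>UNIV. if j = i then c $ j else 1)"
      by (rule prod.cong) (auto simp: lookup_single when_def)
    then show ?thesis
      by simp
  qed
  then show ?thesis
    by (simp add: linear_form_def poly_eval_sum var_def mult_single poly_eval_single)
qed

text \<open>Over an infinite field, finitely many proper hyperplanes do not cover the space.\<close>

lemma avoid_hyperplanes:
  fixes A :: "(complex ^ 'n::finite) set"
  assumes "finite A" "0 \<notin> A"
  shows "\<exists>c. \<forall>a\<in>A. (\<Sum>i\<in>UNIV. a $ i * c $ i) \<noteq> 0"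
  using assms
proof (induction A)
  case (insert a A)
  then obtain c where c: "\<And>b. b \<in> A \<Longrightarrow> (\<Sum>i\<in>UNIV. b $ i * c $ i) \<noteq> 0"
    by auto
  obtain j where j: "a $ j \<noteq> 0"
    using insert.prems by (metis insertI1 vec_eq_iff zero_index)
  define w where "w t = (\<chi> i. c $ i + (if i = j then t else 0))" for t
  have w: "(\<Sum>i\<in>UNIV. b $ i * w t $ i) = (\<Sum>i\<in>UNIV. b $ i * c $ i) + b $ j * t" for b t
  proof -
    have "(\<Sum>i\<in>UNIV. b $ i * w t $ i) = (\<Sum>i\<in>UNIV. b $ i * c $ i + (if i = j then b $ j * t else 0))"
      by (rule sum.cong) (auto simp: w_def distrib_left)
    then show ?thesis
      by (simp add: sum.distrib)
  qed
  have "finite {t. (\<Sum>i\<in>UNIV. b $ i * w t $ i) = 0}" if "b \<in> insert a A" for b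
  proof (cases "b $ j = 0")
    case True
    then show ?thesis
      using c[of b] that j by (auto simp: w)
  next
    case False
    have "{t. (\<Sum>i\<in>UNIV. b $ i * w t $ i) = 0} \<subseteq> {- (\<Sum>i\<in>UNIV. b $ i * c $ i) / b $ j}"
      using False by (auto simp: w field_simps eq_neg_iff_add_eq_0)
    then show ?thesis
      using finite_subset by blast
  qed
  then have "finite (\<Union>b\<in>insert a A. {t. (\<Sum>i\<in>UNIV. b $ i * w t $ i) = 0})"
    using insert.hyps(1) by blast
  then obtain t where "t \<notin> (\<Union>b\<in>insert a A. {t. (\<Sum>i\<in>UNIV. b $ i * w t $ i) = 0})"
    using ex_new_if_finite[OF infinite_UNIV_char_0] by blast
  then show ?case
    by blast
qed simp

text \<open>The linear forms in \<open>P\<close> form a proper subspace of all linear forms.  It lies in a hyperplane, found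
  as the kernel of a functional that vanishes on \<open>P\<close> but not at some variable, and \<open>Z\<close> is the union of
  these hyperplanes.\<close>

lemma generic_linear_form_avoids:
  fixes \<P> :: "'n::{finite,linorder} mpoly set set"
  assumes "finite \<P>" and \<P>: "\<And>P. P \<in> \<P> \<Longrightarrow> is_ideal P \<and> \<not> range var \<subseteq> P"
  obtains Z :: "(complex ^ 'n::{finite,linorder}) set" where "zariski_closed Z" "Z \<noteq> UNIV"
    "\<And>c P. c \<notin> Z \<Longrightarrow> P \<in> \<P> \<Longrightarrow> linear_form c \<notin> P"
proof -
  have "\<exists>a :: complex ^ 'n::{finite,linorder}. a \<noteq> 0 \<and> (\<forall>c. linear_form c \<in> P \<longrightarrow> (\<Sum>i\<in>UNIV. a $ i * c $ i) = 0)"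
    if P: "P \<in> \<P>" for P
  proof -
    obtain j where j: "var j \<notin> P"
      using \<P>[OF P] by blast
    obtain \<phi> where \<phi>: "linear_functional \<phi>" "\<And>u. u \<in> P \<Longrightarrow> \<phi> u = 0" "\<phi> (var j) = 1"
      using separating_functional[OF _ j] \<P>[OF P] by blast
    define a :: "complex ^ 'n::{finite,linorder}" where "a = (\<chi> i. \<phi> (var i))"
    have "a $ j \<noteq> 0"
      by (simp add: a_def \<phi>(3))
    then have "a \<noteq> 0"
      by auto
    moreover have "\<phi> (linear_form c) = (\<Sum>i\<in>UNIV. a $ i * c $ i)" for c
      by (simp add: linear_form_def linear_functional_sum[OF \<phi>(1)] linear_functional_scale[OF \<phi>(1)] a_def)
        (simp add: mult.commute)
    ultimately show ?thesis
      using \<phi>(2) by metis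
  qed
  then obtain a :: "_ \<Rightarrow> complex ^ 'n::{finite,linorder}" where a: "\<And>P. P \<in> \<P> \<Longrightarrow> a P \<noteq> 0"
    "\<And>P c. P \<in> \<P> \<Longrightarrow> linear_form c \<in> P \<Longrightarrow> (\<Sum>i\<in>UNIV. a P $ i * c $ i) = 0"
    by metis
  define p where "p = (\<Prod>P\<in>\<P>. linear_form (a P))"
  define Z where "Z = {c. \<forall>q\<in>{p}. poly_eval c q = 0}"
  have Z: "c \<in> Z \<longleftrightarrow> (\<exists>P\<in>\<P>. (\<Sum>i\<in>UNIV. a P $ i * c $ i) = 0)" for c
    using assms(1) by (simp add: Z_def p_def poly_eval_prod poly_eval_linear_form prod_zero_iff)
  show ?thesis
  proof
    show "zariski_closed Z"
      unfolding zariski_closed_def Z_def by blast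
    show "Z \<noteq> UNIV"
      using avoid_hyperplanes[of "a ` \<P>"] assms(1) a(1) Z by fastforce
    show "linear_form c \<notin> P" if "c \<notin> Z" "P \<in> \<P>" for c P
      using that a(2) Z by blast
  qed
qed

lemma linear_form_in_max_ideal: "linear_form c \<in> max_ideal"
  unfolding linear_form_def
proof (rule ideal_sum[OF is_ideal_max_ideal])
  show "Poly_Mapping.single 0 (c $ i) * var i \<in> max_ideal" for i
    by (rule ideal_mult[OF is_ideal_max_ideal var_in_max_ideal])
qed

section \<open>Correctness and termination of the procedure\<close>

text \<open>No s-corner divides another one, since its proper multiples lie in \<open>M\<close>.  So the finite basis that
  Dickson's lemma provides contains all s-corners.\<close>

lemma finite_s_corners:
  fixes M :: "'n::finite monom set"
  assumes M: "\<And>\<alpha> \<gamma>. \<alpha> \<in> M \<Longrightarrow> \<gamma> + \<alpha> \<in> M"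
  shows "finite (s_corners M)"
proof -
  obtain X where X: "finite X" "X \<subseteq> s_corners M"
    "\<And>\<alpha>. \<alpha> \<in> s_corners M \<Longrightarrow> \<exists>\<beta>\<in>X. \<forall>k. Poly_Mapping.lookup \<beta> k \<le> Poly_Mapping.lookup \<alpha> k"
    using Dickson_finite_basis[of "s_corners M" Poly_Mapping.lookup] by blast
  have "\<alpha> \<in> X" if \<alpha>: "\<alpha> \<in> s_corners M" for \<alpha>
  proof -
    obtain \<beta> where \<beta>: "\<beta> \<in> X" "\<And>k. Poly_Mapping.lookup \<beta> k \<le> Poly_Mapping.lookup \<alpha> k"
      using X(3)[OF \<alpha>] by blast
    have "\<alpha> - \<beta> = 0"
    proof (rule ccontr)
      assume "\<alpha> - \<beta> \<noteq> 0"
      then obtain i where i: "Poly_Mapping.lookup (\<alpha> - \<beta>) i \<noteq> 0"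
        by (metis poly_mapping_eqI lookup_zero)
      then have "\<alpha> - \<beta> = (\<alpha> - \<beta> - Poly_Mapping.single i 1) + Poly_Mapping.single i 1"
        by (intro monom_add_diff) (auto simp: lookup_single when_def)
      then have "\<alpha> = (\<alpha> - \<beta> - Poly_Mapping.single i 1) + (Poly_Mapping.single i 1 + \<beta>)"
        using monom_add_diff[of \<beta> \<alpha>, OF \<beta>(2)] by (metis add.assoc)
      moreover have "Poly_Mapping.single i 1 + \<beta> \<in> M"
        using \<beta>(1) X(2) by (auto simp: s_corners_def)
      ultimately have "\<alpha> \<in> M"
        using M by metis
      with \<alpha> show False
        by (simp add: s_corners_def)
    qed
    then show ?thesis
      using monom_add_diff[of \<beta> \<alpha>, OF \<beta>(2)] \<beta>(1) by simp
  qed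
  then show ?thesis
    by (intro finite_subset[OF subsetI X(1)])
qed

lemma Ass_not_containing_variables:
  fixes I :: "'n::{finite,linorder} mpoly set"
  assumes I: "is_ideal I" and P: "P \<in> Ass I" "P \<noteq> max_ideal"
  shows "\<not> range var \<subseteq> P"
proof
  assume "range var \<subseteq> P"
  obtain g where g: "P = {f. f * g \<in> I}" and prime: "is_prime_ideal P"
    using P(1) by (auto simp: Ass_def)
  have "is_ideal P" "P \<noteq> UNIV"
    using prime by (auto simp: is_prime_ideal_def)
  moreover have "max_ideal \<subseteq> P"
    unfolding max_ideal_def by (rule ideal_gen_minimal) fact+
  ultimately show False
    using P(2) max_ideal_maximal by blast
qed

lemma run_procedure_eq:
  assumes "pass r I l d \<noteq> None"
  shows "run_procedure r I l = pass r I l (LEAST d. pass r I l d \<noteq> None)"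
proof -
  have "while_option (\<lambda>d. pass r I l d = None) Suc 0 = Some (LEAST d. pass r I l d \<noteq> None)"
    using assms by (auto simp: while_option_def Suc_funpow)
  then show ?thesis
    by (simp add: run_procedure_def)
qed

lemma run_procedure_Some:
  assumes "pass r I l d = Some b" "\<And>d. pass r I l d \<noteq> Some (\<not> b)"
  shows "run_procedure r I l = Some b"
proof -
  have "pass r I l (LEAST d. pass r I l d \<noteq> None) \<noteq> None"
    by (rule LeastI[of _ d]) (simp add: assms(1))
  then obtain b' where b': "pass r I l (LEAST d. pass r I l d \<noteq> None) = Some b'"
    by blast
  then have "b' = b"
    using assms(2)[of "LEAST d. pass r I l d \<noteq> None"] by (cases b; cases b') auto
  then show ?thesis
    using run_procedure_eq[of r I l d] assms(1) b' by simp
qed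

text \<open>A socle element with initial monomial \<open>\<beta>\<close> outside \<open>in(I)\<close> triggers step (i) and, \<open>\<beta>\<close> being an
  s-corner, blocks step (ii).\<close>

lemma procedure_true:
  fixes I :: "'n::{finite,linorder} mpoly set"
  assumes r: "local_monomial_order r" and I: "is_ideal I" and "max_ideal \<in> Ass I"
    and l: "l \<in> max_ideal"
  shows "run_procedure r I l = Some True"
proof -
  have order: "monomial_order r"
    using r by (auto simp: local_monomial_order_def monomial_order_def)
  have lin: "linear_order r"
    by (rule monomial_order_linear[OF order])
  obtain g where g: "max_ideal = {f. f * g \<in> I}"
    using assms(3) by (auto simp: Ass_def)
  have "1 \<notin> (max_ideal :: 'n mpoly set)"
    by (simp add: max_ideal_iff)
  then have "g \<notin> I"
    by (simp add: g)
  moreover have "x * g \<in> I" if "x \<in> max_ideal" for x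
    using that g by blast
  ultimately obtain f \<beta> where f: "\<And>x. x \<in> max_ideal \<Longrightarrow> x * f \<in> I" "is_lead r f \<beta>" "\<beta> \<notin> initials r I"
    by (rule exists_initial_outside[OF order I]) (assumption, rule that)
  obtain d where d: "f \<in> polys_le d"
    using polys_le_exists by blast
  have "ideal_power max_ideal (Suc 0) \<subseteq> (max_ideal :: 'n mpoly set)"
    unfolding ideal_power.simps
    by (rule ideal_gen_minimal[OF _ is_ideal_max_ideal])
      (auto intro: ideal_mult_right[OF is_ideal_max_ideal])
  moreover have "f * x \<in> I" if "x \<in> max_ideal" for x
    using f(1)[OF that] by (simp add: mult.commute)
  ultimately have "f \<in> colon I (ideal_power max_ideal (Suc 0))"
    unfolding colon_def by blast
  then have "f \<in> saturation I max_ideal"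
    unfolding saturation_def by blast
  then have "\<beta> \<in> initials r (saturation I max_ideal \<inter> polys_le d)"
    using d f(2) by (auto simp: initials_iff[OF lin])
  then have true: "pass r I l d = Some True"
    using f(3) by (auto simp: pass_def)
  have "Poly_Mapping.single i 1 + \<beta> \<in> initials r I" for i
    unfolding initials_iff[OF lin]
    by (intro bexI[of _ "monomial (Poly_Mapping.single i 1) * f"] is_lead_monomial_mult order f)
      (use var_in_max_ideal[of i] in \<open>simp add: var_def\<close>)
  then have "\<beta> \<in> s_corners (initials r I)"
    using f(3) by (simp add: s_corners_def)
  moreover have "\<beta> \<notin> dual_initials r (act l ` dual_space_le (d + 1) I)" for d
    by (rule not_dual_initial[OF lin f(2) f(1)[OF l]])
  ultimately have "pass r I l d \<noteq> Some (\<not> True)" for d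
    by (auto simp: pass_def)
  with true show ?thesis
    by (rule run_procedure_Some)
qed

lemma procedure_false:
  fixes I :: "'n::{finite,linorder} mpoly set"
  assumes r: "local_monomial_order r" and I: "is_ideal I" and "max_ideal \<notin> Ass I"
    and nzd: "\<And>g. l * g \<in> I \<Longrightarrow> g \<in> I"
  shows "run_procedure r I l = Some False"
proof -
  have order: "monomial_order r"
    using r by (auto simp: local_monomial_order_def monomial_order_def)
  have no_true: "initials r (saturation I max_ideal \<inter> polys_le d) \<subseteq> initials r I" for d
    using saturation_eq_if_not_Ass[OF I assms(3)] unfolding initials_def by blast
  have "\<exists>k. \<forall>d\<ge>k. \<alpha> \<in> dual_initials r (act l ` dual_space_le (d + 1) I)"
    if "\<alpha> \<in> s_corners (initials r I)" for \<alpha>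
  proof -
    have "\<alpha> \<notin> initials r I"
      using that by (simp add: s_corners_def)
    from dual_initial_exists[OF r I nzd this] show ?thesis
      by metis
  qed
  then obtain k where k: "\<And>\<alpha> d. \<alpha> \<in> s_corners (initials r I) \<Longrightarrow> k \<alpha> \<le> d \<Longrightarrow>
      \<alpha> \<in> dual_initials r (act l ` dual_space_le (d + 1) I)"
    by metis
  have fin: "finite (s_corners (initials r I))"
    by (rule finite_s_corners) (rule initials_add[OF order I])
  define d where "d = (\<Sum>\<alpha>\<in>s_corners (initials r I). k \<alpha>)"
  have "k \<alpha> \<le> d" if "\<alpha> \<in> s_corners (initials r I)" for \<alpha>
    unfolding d_def using that fin by (intro member_le_sum) auto
  then have "s_corners (initials r I) \<subseteq> dual_initials r (act l ` dual_space_le (d + 1) I)"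
    using k by blast
  then have "pass r I l d = Some False"
    using no_true by (simp add: pass_def)
  moreover have "pass r I l d \<noteq> Some (\<not> False)" for d
    using no_true by (simp add: pass_def)
  ultimately show ?thesis
    by (rule run_procedure_Some)
qed

theorem mainTheorem2:
  fixes F I :: "'n::{finite,linorder} mpoly set"
  assumes "finite F"
    and "I = ideal_gen F"
    and "I = contraction (extension I)"
  shows "\<exists>Z :: (complex ^ 'n::{finite,linorder}) set. zariski_closed Z \<and> Z \<noteq> UNIV \<and>
    (\<forall>r c. local_monomial_order r \<longrightarrow> c \<notin> Z \<longrightarrow>
      (\<exists>b. run_procedure r I (linear_form c) = Some b \<and> (b \<longleftrightarrow> max_ideal \<in> Ass I)))"
proof -
  have I: "is_ideal I"
    unfolding assms(2) by (rule is_ideal_gen)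
  have "finite (Ass I - {max_ideal})"
    using finite_Ass[OF noetherian_mpoly I] by simp
  moreover have "is_ideal P \<and> \<not> range var \<subseteq> P" if "P \<in> Ass I - {max_ideal}" for P
    using that Ass_not_containing_variables[OF I, of P]
    by (auto simp: Ass_def is_prime_ideal_def)
  ultimately obtain Z :: "(complex ^ 'n::{finite,linorder}) set" where Z: "zariski_closed Z" "Z \<noteq> UNIV"
    "\<And>c P. c \<notin> Z \<Longrightarrow> P \<in> Ass I - {max_ideal} \<Longrightarrow> linear_form c \<notin> P"
    by (rule generic_linear_form_avoids) (assumption, rule that)
  have "run_procedure r I (linear_form c) = Some (max_ideal \<in> Ass I)"
    if r: "local_monomial_order r" and c: "c \<notin> Z" for r c
  proof (cases "max_ideal \<in> Ass I")
    case True
    then show ?thesis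
      using procedure_true[OF r I True linear_form_in_max_ideal] by simp
  next
    case False
    have "g \<in> I" if lg: "linear_form c * g \<in> I" for g
    proof (rule ccontr)
      assume "g \<notin> I"
      then obtain P where "P \<in> Ass I" "linear_form c \<in> P"
        using zero_divisor_in_Ass[OF noetherian_mpoly I _ lg] by blast
      with False Z(3)[OF c, of P] show False
        by blast
    qed
    then show ?thesis
      using procedure_false[OF r I False] False by simp
  qed
  with Z(1,2) show ?thesis
    by blast
qed

end
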